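(* Let $t>\frac12$, $s\ge\frac12$, and let $K:L^2(\mathbb{T})\to L^2(\mathbb{T})$ be a bounded linear operator such that: (a) for every $\ell\in\mathbb{N}$ there exists $w^{(\ell)}\in L^2(\mathbb{T})$ with $K^*w^{(\ell)}=\psi_\ell$; (b) there is $C>0$ such that $\frac1C\|\psi\|_{B_2^r}\le\|K\psi\|_{B_2^{t+r}}\le C\|\psi\|_{B_2^r}$ for all $r\in\mathbb{R}$ and $\psi\in B_2^r(\mathbb{T})$, and the same holds with $K^*$ in place of $K$. Let $R(u)=\|u\|_{B_1^s(\mathbb{T})}=\sum_{\ell=1}^\infty\ell^{s-1/2}|u_\ell|$ and let $u^\dagger$ be supported on a finite number of coefficients. Then (a suitable subgradient) $\mu^\dagger\in\partial R(u^\dagger)$ satisfies, for any $r_1\ge0$, the approximate source condition of order $r_1$: $$\inf_{w\in L^2(\mathbb{T})}\{\|w\|_{L^2}^2:\ S(\mu^\dagger-K^*w)\le\beta\}\le C_1\beta^{-r_1}\quad\text{for all sufficiently small }\beta>0.$$ For the choice $\alpha\simeq\delta^\kappa$, where $$\kappa=\frac{2s+2t}{2s+2t+1},$$ we obtain the convergence rate $$\mathbb{E}\,D_R^{\mu_\alpha^\delta,\mu^\dagger}(U_\alpha^\delta,u^\dagger)\lesssim\delta^\kappa.$$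
   Context: $\{\psi_\ell\}_{\ell=1}^\infty$ is an orthonormal wavelet basis (globally indexed, sufficiently regular to characterize the Besov spaces used) of $L^2(\mathbb{T})$, $\mathbb{T}$ the one-dimensional torus; $u=\sum_\ell u_\ell\psi_\ell$, and the Besov space $B_p^s(\mathbb{T})=B_{pp}^s(\mathbb{T})$ is normed by $\|u\|_{B_p^s}=\big(\sum_{\ell}\ell^{p(s+\frac12)-1}|u_\ell|^p\big)^{1/p}$. $X=Y=L^2(\mathbb{T})$ and $R=\infty$ outside $B^s_1(\mathbb{T})$. The dual norm is $S(q)=\|q\|_{B_\infty^{-s}(\mathbb{T})}=\sup_\ell\ell^{1/2-s}|q_\ell|$. $N$ is Gaussian white noise on $\mathbb{T}$: a centered Gaussian random variable in $\mathcal{D}'(\mathbb{T})$ with $\mathbb{E}\langle N,\phi\rangle\langle N,\psi\rangle=\langle\phi,\psi\rangle$ for test functions; almost surely $N\in H^{-1/2-\epsilon}(\mathbb{T})$ for every $\epsilon>0$. The data are $F^\delta=Ku^\dagger+\delta N$, $\delta>0$, with deterministic $u^\dagger$. $U_\alpha^\delta$ is, realization-wise, a minimizer of $\frac12\|Ku\|_{L^2}^2-\langle Ku,F^\delta\rangle_{B_2^t\times B_2^{-t}}+\alpha R(u)$, and $\mu_\alpha^\delta\in\partial R(U_\alpha^\delta)$ is the subgradient with $K^*(KU_\alpha^\delta-F^\delta)+\alpha\mu_\alpha^\delta=0$. The symmetric Bregman distance is $D_R^{\mu_u,\mu_v}(u,v)=\langle\mu_u-\mu_v,u-v\rangle$.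 $a\simeq b$ means mutual boundedness by constant multiples and $a\lesssim b$ means $a\le Cb$, with constants independent of $\delta$, as $\delta\to0$. *)

theory Defs
  imports "HOL-Probability.Probability" "HOL-Library.Landau_Symbols"
begin

section \<open>The real Hilbert space of square integrable functions on the torus\<close>

text \<open>The torus is \<open>\<real>/\<int>\<close> with fundamental domain \<open>[0,1)\<close>. Elements of \<open>L2_torus\<close> are classes
  of square integrable functions modulo equality almost everywhere on \<open>[0,1)\<close>; the values of a
  representative outside \<open>[0,1)\<close> are irrelevant.\<close>

definition torus :: "real measure" where
  "torus = restrict_space lborel {0..<1}"

definition square_integrable :: "(real \<Rightarrow> real) \<Rightarrow> bool" where
  "square_integrable f \<longleftrightarrow> f \<in> borel_measurable torus \<and> integrable torus (\<lambda>x. (f x)\<^sup>2)"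

lemma square_integrable_zero: "square_integrable (\<lambda>_. 0)"
  by (simp add: square_integrable_def)

lemma square_integrable_mult:
  assumes "square_integrable f" "square_integrable g"
  shows "integrable torus (\<lambda>x. f x * g x)"
proof (rule Bochner_Integration.integrable_bound)
  show "integrable torus (\<lambda>x. (f x)\<^sup>2 + (g x)\<^sup>2)"
    using assms by (simp add: square_integrable_def)
  show "(\<lambda>x. f x * g x) \<in> borel_measurable torus"
    using assms by (auto simp: square_integrable_def)
  have "\<bar>a * b\<bar> \<le> a\<^sup>2 + b\<^sup>2" for a b :: real
  proof -
    have "0 \<le> (\<bar>a\<bar> - \<bar>b\<bar>)\<^sup>2" by simp
    then have "2 * (\<bar>a\<bar> * \<bar>b\<bar>) \<le> a\<^sup>2 + b\<^sup>2" by (simp add: power2_diff)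
    moreover have "0 \<le> \<bar>a\<bar> * \<bar>b\<bar>" by simp
    ultimately show ?thesis unfolding abs_mult by linarith
  qed
  then show "AE x in torus. norm (f x * g x) \<le> norm ((f x)\<^sup>2 + (g x)\<^sup>2)"
    by (intro AE_I2) (simp add: order_trans[OF _ abs_ge_self])
qed

lemma square_integrable_add:
  assumes "square_integrable f" "square_integrable g"
  shows "square_integrable (\<lambda>x. f x + g x)"
proof -
  have "integrable torus (\<lambda>x. (f x)\<^sup>2 + (g x)\<^sup>2 + 2 * (f x * g x))"
    using assms square_integrable_mult[OF assms] by (simp add: square_integrable_def)
  moreover have "(\<lambda>x. (f x)\<^sup>2 + (g x)\<^sup>2 + 2 * (f x * g x)) = (\<lambda>x. (f x + g x)\<^sup>2)"
    by (simp add: power2_sum mult.assoc)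
  ultimately show ?thesis
    using assms by (auto simp: square_integrable_def)
qed

lemma square_integrable_scale:
  assumes "square_integrable f"
  shows "square_integrable (\<lambda>x. c * f x)"
  using assms by (auto simp: square_integrable_def power_mult_distrib)

quotient_type L2_torus = "real \<Rightarrow> real" / partial:
  "\<lambda>f g. square_integrable f \<and> square_integrable g \<and> (AE x in torus. f x = g x)"
  morphisms L2_rep L2_class
proof (rule part_equivpI)
  show "\<exists>f. square_integrable f \<and> square_integrable f \<and> (AE x in torus. f x = f x)"
    using square_integrable_zero by auto
  show "symp (\<lambda>f g. square_integrable f \<and> square_integrable g \<and> (AE x in torus. f x = g x))"
    by (rule sympI) (auto elim: AE_mp)
  show "transp (\<lambda>f g. square_integrable f \<and> square_integrable g \<and> (AE x in torus. f x = g x))"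
    by (rule transpI) auto
qed

instantiation L2_torus :: real_inner
begin

lift_definition zero_L2_torus :: L2_torus is "\<lambda>_. 0"
  by (simp add: square_integrable_zero)

lift_definition plus_L2_torus :: "L2_torus \<Rightarrow> L2_torus \<Rightarrow> L2_torus" is "\<lambda>f g x. f x + g x"
  by (auto intro: square_integrable_add)

lift_definition uminus_L2_torus :: "L2_torus \<Rightarrow> L2_torus" is "\<lambda>f x. - f x"
  using square_integrable_scale[where c = "-1"] by auto

lift_definition minus_L2_torus :: "L2_torus \<Rightarrow> L2_torus \<Rightarrow> L2_torus" is "\<lambda>f g x. f x - g x"
  using square_integrable_add square_integrable_scale[where c = "-1"] by fastforce

lift_definition scaleR_L2_torus :: "real \<Rightarrow> L2_torus \<Rightarrow> L2_torus" is "\<lambda>c f x. c * f x"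
  by (auto intro: square_integrable_scale)

lift_definition inner_L2_torus :: "L2_torus \<Rightarrow> L2_torus \<Rightarrow> real" is "\<lambda>f g. \<integral>x. f x * g x \<partial>torus"
  by (rule integral_cong_AE) (auto simp: square_integrable_def)

definition norm_L2_torus :: "L2_torus \<Rightarrow> real" where
  "norm_L2_torus f = sqrt (inner f f)"

definition sgn_L2_torus :: "L2_torus \<Rightarrow> L2_torus" where
  "sgn_L2_torus f = inverse (norm f) *\<^sub>R f"

definition dist_L2_torus :: "L2_torus \<Rightarrow> L2_torus \<Rightarrow> real" where
  "dist_L2_torus f g = norm (f - g)"

definition uniformity_L2_torus :: "(L2_torus \<times> L2_torus) filter" where
  "uniformity_L2_torus = (INF e\<in>{0<..}. principal {(x, y). dist x y < e})"

definition open_L2_torus :: "L2_torus set \<Rightarrow> bool" where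
  "open_L2_torus U \<longleftrightarrow> (\<forall>x\<in>U. \<forall>\<^sub>F (x', y) in uniformity. x' = x \<longrightarrow> y \<in> U)"

instance
proof
  fix f g h :: L2_torus and a b :: real and U :: "L2_torus set"
  show "f + g + h = f + (g + h)"
    by transfer (auto intro!: square_integrable_add simp: add.assoc)
  show "f + g = g + f"
    by transfer (auto intro!: square_integrable_add simp: add.commute)
  show "0 + f = f"
    by transfer auto
  show "- f + f = 0"
    by transfer (auto simp: square_integrable_zero)
  show "f - g = f + - g"
    by transfer (use square_integrable_add square_integrable_scale[where c = "-1"] in fastforce)
  show "a *\<^sub>R (f + g) = a *\<^sub>R f + a *\<^sub>R g"
    by transfer (auto intro!: square_integrable_add square_integrable_scale simp: distrib_left)
  show "(a + b) *\<^sub>R f = a *\<^sub>R f + b *\<^sub>R f"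
    by transfer (auto intro!: square_integrable_add square_integrable_scale simp: distrib_right)
  show "a *\<^sub>R b *\<^sub>R f = (a * b) *\<^sub>R f"
    by transfer (auto intro!: square_integrable_scale simp: mult.assoc)
  show "1 *\<^sub>R f = f"
    by transfer auto
  show "inner f g = inner g f"
    by transfer (simp add: mult.commute)
  show "inner (f + g) h = inner f h + inner g h"
    by transfer (simp add: distrib_right square_integrable_mult)
  show "inner (a *\<^sub>R f) g = a * inner f g"
    by transfer (simp add: mult.assoc)
  show "0 \<le> inner f f"
    by transfer simp
  show "inner f f = 0 \<longleftrightarrow> f = 0"
  proof transfer
    fix f :: "real \<Rightarrow> real"
    assume "square_integrable f \<and> square_integrable f \<and> (AE x in torus. f x = f x)"
    then have f: "square_integrable f" by simp
    have "(\<integral>x. f x * f x \<partial>torus) = 0 \<longleftrightarrow> (AE x in torus. f x * f x = 0)"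
      by (rule integral_nonneg_eq_0_iff_AE) (auto intro: square_integrable_mult f)
    then show "(\<integral>x. f x * f x \<partial>torus) = 0 \<longleftrightarrow>
        square_integrable f \<and> square_integrable (\<lambda>_. 0) \<and> (AE x in torus. f x = 0)"
      using f square_integrable_zero by simp
  qed
qed (simp_all add: norm_L2_torus_def sgn_L2_torus_def dist_L2_torus_def
      uniformity_L2_torus_def open_L2_torus_def)

end

section \<open>Distributions on the torus\<close>

definition smooth :: "(real \<Rightarrow> real) \<Rightarrow> bool" where
  "smooth f \<longleftrightarrow> (\<forall>n x. (deriv ^^ n) f differentiable (at x))"

definition test_functions :: "(real \<Rightarrow> real) set" where
  "test_functions = {\<phi>. smooth \<phi> \<and> (\<forall>x. \<phi> (x + 1) = \<phi> x)}"

text \<open>Distributions are functionals on test functions; their values elsewhere carry no meaning.\<close>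

definition distribution :: "((real \<Rightarrow> real) \<Rightarrow> real) \<Rightarrow> bool" where
  "distribution T \<longleftrightarrow>
    (\<forall>\<phi>\<in>test_functions. \<forall>\<eta>\<in>test_functions. \<forall>a b.
       T (\<lambda>x. a * \<phi> x + b * \<eta> x) = a * T \<phi> + b * T \<eta>) \<and>
    (\<exists>m C. \<forall>\<phi>\<in>test_functions. \<bar>T \<phi>\<bar> \<le> C * (\<Sum>j\<le>m. SUP x\<in>{0..1}. \<bar>(deriv ^^ j) \<phi> x\<bar>))"

definition dist_of :: "L2_torus \<Rightarrow> (real \<Rightarrow> real) \<Rightarrow> real" where
  "dist_of f \<phi> = inner f (L2_class \<phi>)"

section \<open>Wavelet bases and Besov spaces\<close>

definition schwartz :: "(real \<Rightarrow> real) \<Rightarrow> bool" where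
  "schwartz f \<longleftrightarrow> smooth f \<and> (\<forall>m n. bounded (range (\<lambda>x. x ^ m * (deriv ^^ n) f x)))"

definition periodized :: "(real \<Rightarrow> real) \<Rightarrow> nat \<Rightarrow> nat \<Rightarrow> real \<Rightarrow> real" where
  "periodized f j k x = (\<Sum>\<^sub>\<infinity>m\<in>(UNIV :: int set). 2 powr (j / 2) * f (2 ^ j * (x + of_int m) - k))"

text \<open>The basis is indexed by \<open>\<ell> \<ge> 1\<close>, the value at \<open>0\<close> being irrelevant. The first \<open>2\<^sup>J\<close> elements
  are the periodized scaling functions of the coarsest level \<open>J\<close>, and the wavelets of level
  \<open>j \<ge> J\<close> occupy, in any order, the positions \<open>2\<^sup>j < \<ell> \<le> 2\<^sup>j\<^sup>+\<^sup>1\<close>. Regularity of every order in the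
  sense of Meyer (smoothness and rapid decay of all derivatives) is what makes the coefficients
  characterize the Besov spaces of all smoothness orders. Membership in \<open>test_functions\<close> already
  follows from it.\<close>

definition wavelet_basis :: "(nat \<Rightarrow> real \<Rightarrow> real) \<Rightarrow> bool" where
  "wavelet_basis \<psi> \<longleftrightarrow>
    (\<forall>l\<ge>1. \<psi> l \<in> test_functions) \<and>
    (\<exists>f g J. schwartz f \<and> schwartz g \<and>
       \<psi> ` {1..2 ^ J} = periodized f J ` {..<2 ^ J} \<and>
       (\<forall>j\<ge>J. \<psi> ` {2 ^ j<..2 ^ (j + 1)} = periodized g j ` {..<2 ^ j})) \<and>
    (\<forall>l\<ge>1. \<forall>m\<ge>1. inner (L2_class (\<psi> l)) (L2_class (\<psi> m)) = (if l = m then 1 else 0)) \<and>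
    closure (span ((\<lambda>l. L2_class (\<psi> l)) ` {1..})) = UNIV"

text \<open>These are meant for finite \<open>p\<close> only; \<open>besov_norm\<close> is meaningful on \<open>besov_space\<close> only.\<close>

definition besov_term ::
    "(nat \<Rightarrow> real \<Rightarrow> real) \<Rightarrow> real \<Rightarrow> real \<Rightarrow> ((real \<Rightarrow> real) \<Rightarrow> real) \<Rightarrow> nat \<Rightarrow> real" where
  "besov_term \<psi> p s T l = real l powr (p * (s + 1/2) - 1) * \<bar>T (\<psi> l)\<bar> powr p"

definition besov_space ::
    "(nat \<Rightarrow> real \<Rightarrow> real) \<Rightarrow> real \<Rightarrow> real \<Rightarrow> ((real \<Rightarrow> real) \<Rightarrow> real) set" where
  "besov_space \<psi> p s = {T. distribution T \<and> besov_term \<psi> p s T summable_on {1..}}"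

definition besov_norm ::
    "(nat \<Rightarrow> real \<Rightarrow> real) \<Rightarrow> real \<Rightarrow> real \<Rightarrow> ((real \<Rightarrow> real) \<Rightarrow> real) \<Rightarrow> real" where
  "besov_norm \<psi> p s T = (\<Sum>\<^sub>\<infinity>l\<in>{1..}. besov_term \<psi> p s T l) powr (1 / p)"

text \<open>The norm of \<open>B\<^sub>\<infinity>\<^sup>s\<close>, infinite outside that space.\<close>

definition besov_infty_norm ::
    "(nat \<Rightarrow> real \<Rightarrow> real) \<Rightarrow> real \<Rightarrow> ((real \<Rightarrow> real) \<Rightarrow> real) \<Rightarrow> ereal" where
  "besov_infty_norm \<psi> s T = (SUP l\<in>{1..}. ereal (real l powr (1/2 + s) * \<bar>T (\<psi> l)\<bar>))"

text \<open>The duality pairing of \<open>B\<^sub>2\<^sup>r\<close> and \<open>B\<^sub>2\<^sup>-\<^sup>r\<close>; it does not depend on \<open>r\<close>.\<close>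

definition pairing ::
    "(nat \<Rightarrow> real \<Rightarrow> real) \<Rightarrow> ((real \<Rightarrow> real) \<Rightarrow> real) \<Rightarrow> ((real \<Rightarrow> real) \<Rightarrow> real) \<Rightarrow> real" where
  "pairing \<psi> T T' = (\<Sum>\<^sub>\<infinity>l\<in>{1..}. T (\<psi> l) * T' (\<psi> l))"

text \<open>For an operator \<open>A\<close> on \<open>L\<^sup>2\<close>, \<open>transposed \<psi> A\<close> is the action of the adjoint of \<open>A\<close> on
  distributions, \<open>\<phi> \<mapsto> \<langle>A \<phi>, T\<rangle>\<close>. So \<open>transposed \<psi> K\<close> extends \<open>K\<^sup>*\<close>, and \<open>transposed \<psi> K\<^sup>*\<close>
  extends \<open>K\<close>.\<close>

definition transposed ::
    "(nat \<Rightarrow> real \<Rightarrow> real) \<Rightarrow> (L2_torus \<Rightarrow> L2_torus) \<Rightarrow>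
      ((real \<Rightarrow> real) \<Rightarrow> real) \<Rightarrow> (real \<Rightarrow> real) \<Rightarrow> real" where
  "transposed \<psi> A T \<phi> = pairing \<psi> (dist_of (A (L2_class \<phi>))) T"

definition smoothing_with ::
    "(nat \<Rightarrow> real \<Rightarrow> real) \<Rightarrow> real \<Rightarrow> real \<Rightarrow>
      (((real \<Rightarrow> real) \<Rightarrow> real) \<Rightarrow> ((real \<Rightarrow> real) \<Rightarrow> real)) \<Rightarrow> bool" where
  "smoothing_with \<psi> t C A \<longleftrightarrow>
    (\<forall>r. \<forall>T\<in>besov_space \<psi> 2 r. A T \<in> besov_space \<psi> 2 (t + r) \<and>
       1 / C * besov_norm \<psi> 2 r T \<le> besov_norm \<psi> 2 (t + r) (A T) \<and>
       besov_norm \<psi> 2 (t + r) (A T) \<le> C * besov_norm \<psi> 2 r T)"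

section \<open>Gaussian white noise\<close>

definition centered_gaussian :: "'w measure \<Rightarrow> ('w \<Rightarrow> real) \<Rightarrow> bool" where
  "centered_gaussian M X \<longleftrightarrow> X \<in> borel_measurable M \<and>
    ((AE \<omega> in M. X \<omega> = 0) \<or>
     (\<exists>\<sigma>>0. distributed M lborel X (\<lambda>x. ennreal (normal_density 0 \<sigma> x))))"

definition white_noise :: "'w measure \<Rightarrow> ('w \<Rightarrow> (real \<Rightarrow> real) \<Rightarrow> real) \<Rightarrow> bool" where
  "white_noise M N \<longleftrightarrow> prob_space M \<and>
    (\<forall>\<omega>\<in>space M. distribution (N \<omega>)) \<and>
    (\<forall>\<phi>\<in>test_functions. centered_gaussian M (\<lambda>\<omega>. N \<omega> \<phi>)) \<and>
    (\<forall>\<phi>\<in>test_functions. \<forall>\<eta>\<in>test_functions.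
       (\<integral>\<omega>. N \<omega> \<phi> * N \<omega> \<eta> \<partial>M) = inner (L2_class \<phi>) (L2_class \<eta>))"

section \<open>Regularization\<close>

definition besov_penalty :: "(nat \<Rightarrow> real \<Rightarrow> real) \<Rightarrow> real \<Rightarrow> L2_torus \<Rightarrow> ereal" where
  "besov_penalty \<psi> s u =
    (if dist_of u \<in> besov_space \<psi> 1 s then ereal (besov_norm \<psi> 1 s (dist_of u)) else \<infinity>)"

text \<open>The dual of \<open>L\<^sup>2\<close> is identified with \<open>L\<^sup>2\<close>.\<close>

definition subdifferential :: "('a::real_inner \<Rightarrow> ereal) \<Rightarrow> 'a \<Rightarrow> 'a set" where
  "subdifferential R u =
    {\<mu>. R u \<noteq> \<infinity> \<and> (\<forall>v. R u + ereal (inner \<mu> (v - u)) \<le> R v)}"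

definition bregman :: "'a::real_inner \<Rightarrow> 'a \<Rightarrow> 'a \<Rightarrow> 'a \<Rightarrow> real" where
  "bregman \<mu> \<nu> u v = inner (\<mu> - \<nu>) (u - v)"

definition data ::
    "L2_torus \<Rightarrow> ((real \<Rightarrow> real) \<Rightarrow> real) \<Rightarrow> real \<Rightarrow> (real \<Rightarrow> real) \<Rightarrow> real" where
  "data y n \<delta> \<phi> = dist_of y \<phi> + \<delta> * n \<phi>"

definition objective ::
    "(nat \<Rightarrow> real \<Rightarrow> real) \<Rightarrow> (L2_torus \<Rightarrow> L2_torus) \<Rightarrow> (L2_torus \<Rightarrow> ereal) \<Rightarrow>
      ((real \<Rightarrow> real) \<Rightarrow> real) \<Rightarrow> real \<Rightarrow> L2_torus \<Rightarrow> ereal" where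
  "objective \<psi> K R F \<alpha> u =
    ereal (1/2 * (norm (K u))\<^sup>2 - pairing \<psi> (dist_of (K u)) F) + ereal \<alpha> * R u"

text \<open>\<open>u\<close> is a minimizer for the data \<open>F\<close> and \<open>\<mu>\<close> its subgradient, the optimality condition
  \<open>K\<^sup>*(K u - F) + \<alpha> \<mu> = 0\<close> being an identity of distributions.\<close>

definition regularized_solution ::
    "(nat \<Rightarrow> real \<Rightarrow> real) \<Rightarrow> (L2_torus \<Rightarrow> L2_torus) \<Rightarrow> (L2_torus \<Rightarrow> ereal) \<Rightarrow>
      ((real \<Rightarrow> real) \<Rightarrow> real) \<Rightarrow> real \<Rightarrow> L2_torus \<Rightarrow> L2_torus \<Rightarrow> bool" where
  "regularized_solution \<psi> K R F \<alpha> u \<mu> \<longleftrightarrow>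
    is_arg_min (objective \<psi> K R F \<alpha>) (\<lambda>_. True) u \<and>
    \<mu> \<in> subdifferential R u \<and>
    (\<forall>\<phi>\<in>test_functions.
       transposed \<psi> K (\<lambda>\<eta>. dist_of (K u) \<eta> - F \<eta>) \<phi> + \<alpha> * dist_of \<mu> \<phi> = 0)"

end

theory Submission
  imports Defs
begin

text \<open>
  Write \<open>e l\<close> for the basis, \<open>v = U - u\<close> for the error with the true solution \<open>u\<close>, and index
  coefficients by subscripts. Take the subgradient \<open>\<nu>\<close> at \<open>u\<close> that vanishes off the finite support
  of \<open>u\<close>. It is a finite combination of basis elements, hence \<open>\<nu> = K\<^sup>* w\<close> for some \<open>w\<close>, and this
  \<open>w\<close> alone proves the approximate source condition of every order.

  For the rate, the optimality condition tested with \<open>v\<close> gives, for the Bregman distance \<open>D\<close>,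
  \<open>\<alpha> D + \<parallel>K v\<parallel>\<^sup>2 = \<delta> \<Sum>\<^sub>l X\<^sub>l v\<^sub>l - \<alpha> \<langle>w, K v\<rangle>\<close>, where \<open>X\<^sub>l = \<langle>K (e l), N\<rangle>\<close>. The last term is
  harmless: the square \<open>\<parallel>K v\<parallel>\<^sup>2\<close> absorbs it at the price of \<open>\<alpha>\<^sup>2 \<parallel>w\<parallel>\<^sup>2\<close>. The noise term is split frequency
  by frequency, depending on the realization. Since \<open>u\<close> is sparse, \<open>D\<close> dominates the sum of
  \<open>l powr (s - 1/2) * \<bar>v\<^sub>l\<bar>\<close> over the complement of the support (\<open>bregman_dominates\<close>). So all
  frequencies there with \<open>\<delta> \<bar>X\<^sub>l\<bar> \<le> \<alpha> / 2 * l powr (s - 1/2)\<close> are absorbed by \<open>\<alpha> D / 2\<close>. The others,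
  and those in the support, are written as \<open>K\<^sup>* W\<close>. Their contribution \<open>\<delta> \<langle>W, K v\<rangle>\<close> costs
  \<open>\<delta>\<^sup>2 \<parallel>W\<parallel>\<^sup>2\<close>, and the lower smoothing bound of \<open>K\<^sup>*\<close> controls \<open>\<parallel>W\<parallel>\<^sup>2\<close> by the sum of \<open>l powr (2 * t) * X\<^sub>l\<^sup>2\<close>
  over these frequencies. Above the threshold \<open>X\<^sub>l\<^sup>2\<close> is at most
  \<open>X\<^sub>l ^ 4 * (2 * \<delta> / \<alpha>)\<^sup>2 * l powr (1 - 2 * s)\<close>; for each of the finitely many
  frequencies in the support, a fixed multiple of \<open>(\<alpha> / \<delta>)\<^sup>2\<close> has to be added. Altogether, in \<open>bregman_estimate\<close>,
  \<open>D \<le> A \<alpha> + \<delta> ^ 4 / \<alpha> ^ 3 * Z\<close>, with a constant \<open>A\<close> and with \<open>Z\<close> a multiple of the sum of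
  \<open>l powr (2 * t + 1 - 2 * s) * X\<^sub>l ^ 4\<close> over all \<open>l\<close>.

  The variables \<open>X\<^sub>l\<close> are Gaussian with standard deviation at most a multiple of \<open>l powr (- t)\<close> by the
  upper smoothing bound, so \<open>Z\<close> has finite expectation because the sum of
  \<open>l powr (1 - 2 * s - 2 * t)\<close> converges, and this is what \<open>t > 1/2\<close> and \<open>s \<ge> 1/2\<close> ensure
  (\<open>white_noise_fourth_moment_series\<close>, \<open>bregman_bound\<close>). Finally, for \<open>\<alpha>\<close> of the order \<open>\<delta> powr \<kappa>\<close> with
  \<open>\<kappa> \<le> 1\<close>, the term \<open>\<delta> ^ 4 / \<alpha> ^ 3\<close> is of no larger order than \<open>\<alpha>\<close> (\<open>rate_of_bound\<close>).
\<close>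

section \<open>Orthonormal bases of inner product spaces\<close>

lemma has_sum_partial_sums:
  fixes f :: "nat \<Rightarrow> 'b::{comm_monoid_add, topological_space}"
  assumes "(f has_sum S) {1..}"
  shows "(\<lambda>n. \<Sum>l=1..n. f l) \<longlonglongrightarrow> S"
proof -
  have "filterlim (\<lambda>n. {1..n}) (finite_subsets_at_top {1..}) (sequentially :: nat filter)"
    unfolding filterlim_finite_subsets_at_top
  proof (intro allI impI)
    fix B :: "nat set" assume B: "finite B \<and> B \<subseteq> {1..}"
    then obtain k where k: "\<forall>l\<in>B. l \<le> k" by (metis finite_nat_set_iff_bounded_le)
    have "B \<subseteq> {1..n}" if "k \<le> n" for n
      using B k that by (meson atLeastAtMost_iff atLeast_iff order_trans subset_iff)
    then show "\<forall>\<^sub>F n in sequentially. finite {1..n} \<and> B \<subseteq> {1..n} \<and> {1..n} \<subseteq> {1..}"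
      by (intro eventually_sequentiallyI[of k]) auto
  qed
  then show ?thesis
    using assms unfolding has_sum_def by (rule filterlim_compose[rotated])
qed

locale orthonormal_basis =
  fixes e :: "nat \<Rightarrow> 'a::real_inner"
  assumes orthonormal: "\<And>l m. l \<ge> 1 \<Longrightarrow> m \<ge> 1 \<Longrightarrow> inner (e l) (e m) = (if l = m then 1 else 0)"
    and total: "closure (span (e ` {1..})) = UNIV"
begin

lemma inner_sum_basis:
  assumes "finite B" "B \<subseteq> {1..}" "m \<ge> 1"
  shows "inner (\<Sum>l\<in>B. c l *\<^sub>R e l) (e m) = (if m \<in> B then c m else 0)"
proof -
  have "inner (\<Sum>l\<in>B. c l *\<^sub>R e l) (e m) = (\<Sum>l\<in>B. if l = m then c m else 0)"
    unfolding inner_sum_left using assms by (intro sum.cong) (auto simp: orthonormal subset_iff)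
  then show ?thesis
    using assms(1) by (simp add: sum.delta)
qed

definition proj :: "nat \<Rightarrow> 'a \<Rightarrow> 'a" where
  "proj n x = (\<Sum>l=1..n. inner x (e l) *\<^sub>R e l)"

lemma proj_diff: "proj n (x - y) = proj n x - proj n y"
  by (simp add: proj_def inner_diff_left scaleR_diff_left sum_subtractf)

lemma inner_proj: "inner (proj n x) y = (\<Sum>l=1..n. inner x (e l) * inner y (e l))"
  by (simp add: proj_def inner_sum_left inner_commute[of y])

lemma pythagoras_proj: "(norm x)\<^sup>2 = (norm (proj n x))\<^sup>2 + (norm (x - proj n x))\<^sup>2"
proof -
  have "inner (proj n x) (proj n x) = inner (proj n x) x"
    unfolding inner_proj[of n x x] inner_proj[of n x "proj n x"]
    by (intro sum.cong refl) (simp add: proj_def inner_sum_basis subset_iff)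
  then show ?thesis
    by (simp add: power2_norm_eq_inner algebra_simps inner_commute)
qed

lemma norm_proj_le: "norm (proj n x) \<le> norm x"
  by (rule power2_le_imp_le) (simp_all add: pythagoras_proj[of x n])

lemma norm_diff_proj_le: "norm (x - proj n x) \<le> norm x"
  by (rule power2_le_imp_le) (simp_all add: pythagoras_proj[of x n])

lemma proj_span:
  assumes "y \<in> span (e ` {1..})"
  shows "\<forall>\<^sub>F n in sequentially. proj n y = y"
  using assms
proof (induction rule: span_induct_alt)
  case base
  show ?case by (simp add: proj_def)
next
  case (step c x y)
  from step(1) obtain m where m: "m \<ge> 1" "x = e m" by auto
  show ?case
    using step(2) eventually_ge_at_top[of m]
  proof eventually_elim
    case (elim n)
    have "proj n (c *\<^sub>R x + y) = c *\<^sub>R (\<Sum>l=1..n. inner x (e l) *\<^sub>R e l) + proj n y"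
      by (simp add: proj_def inner_add_left scaleR_add_left sum.distrib scaleR_sum_right)
    also have "(\<Sum>l=1..n. inner x (e l) *\<^sub>R e l) = (\<Sum>l=1..n. if l = m then e m else 0)"
      using m by (intro sum.cong) (auto simp: orthonormal)
    also have "\<dots> = x"
      using m elim by (simp add: sum.delta)
    finally show ?case using elim by simp
  qed
qed

text \<open>\<open>proj n\<close> is eventually the identity on any fixed element of the span, and \<open>id - proj n\<close> is a
  contraction; so density of the span gives convergence everywhere.\<close>

lemma proj_tendsto: "(\<lambda>n. proj n x) \<longlonglongrightarrow> x"
proof (rule tendstoI)
  fix \<epsilon> :: real assume "\<epsilon> > 0"
  have "x \<in> closure (span (e ` {1..}))" unfolding total by simp
  then obtain y where y: "y \<in> span (e ` {1..})" "dist y x < \<epsilon> / 2"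
    using \<open>\<epsilon> > 0\<close> closure_approachable[of x] half_gt_zero by blast
  show "\<forall>\<^sub>F n in sequentially. dist (proj n x) x < \<epsilon>"
    using proj_span[OF y(1)]
  proof eventually_elim
    case (elim n)
    have "x - proj n x = (x - y) - proj n (x - y)"
      by (simp add: proj_diff elim)
    then have "norm (x - proj n x) \<le> norm (x - y)"
      using norm_diff_proj_le[of "x - y" n] by (simp only:)
    then show ?case using y(2) \<open>\<epsilon> > 0\<close> by (simp add: dist_norm norm_minus_commute)
  qed
qed

lemma parseval_tendsto: "(\<lambda>n. \<Sum>l=1..n. inner x (e l) * inner y (e l)) \<longlonglongrightarrow> inner x y"
  using tendsto_inner[OF proj_tendsto[of x] tendsto_const[of y]] by (simp add: inner_proj)

text \<open>The set-indexed version of Parseval's identity, which includes absolute convergence.\<close>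

lemma parseval: "((\<lambda>l. inner x (e l) * inner y (e l)) has_sum inner x y) {1..}"
proof -
  have sq: "(\<lambda>l. (inner x (e l))\<^sup>2) summable_on {1..}" for x
  proof (rule nonneg_bdd_above_summable_on)
    have "(\<Sum>l\<in>B. (inner x (e l))\<^sup>2) \<le> inner x x" if B: "finite B" "B \<subseteq> {1..}" for B
    proof -
      obtain k where k: "\<forall>l\<in>B. l \<le> k" using B(1) by (metis finite_nat_set_iff_bounded_le)
      show ?thesis
      proof (rule LIMSEQ_le_const[OF parseval_tendsto[of x x]], intro exI allI impI)
        fix n assume "k \<le> n"
        then have "B \<subseteq> {1..n}" using B(2) k by (meson atLeastAtMost_iff atLeast_iff order_trans subset_iff)
        then show "(\<Sum>l\<in>B. (inner x (e l))\<^sup>2) \<le> (\<Sum>l=1..n. inner x (e l) * inner x (e l))"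
          unfolding power2_eq_square by (intro sum_mono2) auto
      qed
    qed
    then show "bdd_above (sum (\<lambda>l. (inner x (e l))\<^sup>2) ` {F. F \<subseteq> {1..} \<and> finite F})"
      by (auto intro!: bdd_aboveI2)
  qed simp
  have "(\<lambda>l. norm (inner x (e l) * inner y (e l))) summable_on {1..}"
    by (rule abs_summable_product[where x = "\<lambda>l. inner x (e l)" and y = "\<lambda>l. inner y (e l)"])
      (use sq[of x] sq[of y] in \<open>simp_all only: power2_eq_square real_norm_def abs_mult abs_mult_self_eq\<close>)
  then have "(\<lambda>l. inner x (e l) * inner y (e l)) summable_on {1..}"
    by (rule abs_summable_summable)
  then obtain S where S: "((\<lambda>l. inner x (e l) * inner y (e l)) has_sum S) {1..}"
    by (auto simp: summable_on_def)
  then have "(\<lambda>n. \<Sum>l=1..n. inner x (e l) * inner y (e l)) \<longlonglongrightarrow> S"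
    by (rule has_sum_partial_sums)
  then have "S = inner x y"
    using parseval_tendsto LIMSEQ_unique by blast
  with S show ?thesis by simp
qed

text \<open>The measurability of an inner product of two random vectors is usually derived from second
  countability of the space. A countable orthonormal basis serves as well, through the series of
  products of coordinates.\<close>

lemma measurable_inner:
  fixes f g :: "'w \<Rightarrow> 'a"
  assumes "f \<in> borel_measurable M" "g \<in> borel_measurable M"
  shows "(\<lambda>\<omega>. inner (f \<omega> - x) (g \<omega> - y)) \<in> borel_measurable M"
proof (rule borel_measurable_LIMSEQ_real)
  show "(\<lambda>n. \<Sum>l=1..n. inner (f \<omega> - x) (e l) * inner (g \<omega> - y) (e l)) \<longlonglongrightarrow> inner (f \<omega> - x) (g \<omega> - y)" for \<omega>
    by (rule parseval_tendsto)
  have coeff: "(\<lambda>\<omega>. inner (h \<omega> - z) (e l)) \<in> borel_measurable M" if "h \<in> borel_measurable M" for h z l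
    by (rule measurable_compose[OF that])
      (intro borel_measurable_continuous_onI continuous_intros)
  show "(\<lambda>\<omega>. \<Sum>l=1..n. inner (f \<omega> - x) (e l) * inner (g \<omega> - y) (e l)) \<in> borel_measurable M" for n
    by (intro borel_measurable_sum borel_measurable_times coeff assms)
qed

end

section \<open>The deterministic error estimate\<close>

lemma square_le_trade_off:
  fixes x c :: real
  assumes "c > 0"
  shows "x\<^sup>2 \<le> c + x ^ 4 / c"
proof -
  have "x\<^sup>2 * c \<le> c\<^sup>2 + x ^ 4"
  proof -
    have "2 * (x\<^sup>2 * c) \<le> (x\<^sup>2)\<^sup>2 + c\<^sup>2"
      using sum_squares_bound[of "x\<^sup>2" c] by simp
    moreover have "(x\<^sup>2)\<^sup>2 = x ^ 4" by simp
    moreover have "0 \<le> x\<^sup>2 * c" using assms by simp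
    ultimately show ?thesis by linarith
  qed
  then show ?thesis
    using assms by (simp add: field_simps power2_eq_square)
qed

context orthonormal_basis
begin

text \<open>Here \<open>v\<close> is the error of the regularized solution, \<open>\<mu>\<close> its subgradient, \<open>\<nu>\<close> the subgradient
  at the true solution, \<open>I\<close> the support of the true solution and \<open>X l\<close> the coefficients of \<open>K\<^sup>*\<close>
  applied to the noise. The weights are meant to be \<open>a l = l powr (s - 1/2)\<close>, from the penalty, and
  \<open>b l = l powr t\<close>, from the smoothing of \<open>K\<close>. Testing the optimality condition with \<open>v\<close> gives, for the Bregman distance \<open>D\<close>,
  the identity \<open>\<alpha> D + \<parallel>K v\<parallel>\<^sup>2 = \<delta> \<Sum>\<^sub>l X\<^sub>l v\<^sub>l - \<alpha> \<langle>w, K v\<rangle>\<close>.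
  Outside \<open>I\<close> the coefficients with \<open>\<bar>X l\<bar> \<le> \<theta> * a l\<close>, where \<open>\<theta> = \<alpha> / (2 * \<delta>)\<close>, contribute at most
  \<open>\<alpha> * D / 2\<close>, which the left-hand side absorbs. All other coefficients are collected in \<open>Kadj W\<close>, and
  their contribution \<open>\<delta> * inner W (K v)\<close> is absorbed by \<open>\<parallel>K v\<parallel>\<^sup>2\<close> at the price of \<open>\<delta>\<^sup>2 * \<parallel>W\<parallel>\<^sup>2\<close>. In the
  bound for \<open>W\<close>, large squares \<open>(X l)\<^sup>2\<close> are traded for fourth powers divided by the threshold
  \<open>(\<theta> * a l)\<^sup>2\<close>: the fourth powers, unlike the squares, have a summable expectation for the
  weights that occur here.\<close>

lemma bregman_estimate:
  fixes K Kadj :: "'a \<Rightarrow> 'a" and \<alpha> \<delta> C z :: real and a b X :: "nat \<Rightarrow> real"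
  assumes pos: "\<alpha> > 0" "\<delta> > 0" and a: "\<And>l. l \<ge> 1 \<Longrightarrow> a l > 0"
    and adjoint: "\<And>f g. inner (K f) g = inner f (Kadj g)"
    and stable: "\<And>B c. finite B \<Longrightarrow> B \<subseteq> {1..} \<Longrightarrow>
      \<exists>W. Kadj W = (\<Sum>l\<in>B. c l *\<^sub>R e l) \<and> (norm W)\<^sup>2 \<le> C\<^sup>2 * (\<Sum>l\<in>B. (b l * c l)\<^sup>2)"
    and source: "Kadj w = \<nu>"
    and optimality: "\<And>l. l \<ge> 1 \<Longrightarrow> inner (K (e l)) (K v) - \<delta> * X l + \<alpha> * inner \<mu> (e l) = 0"
    and I: "finite I" "I \<subseteq> {1..}"
    and dominates: "\<And>n. (\<Sum>l\<in>{1..n} - I. a l * \<bar>inner v (e l)\<bar>) \<le> inner (\<mu> - \<nu>) v"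
    and z: "\<And>n. (\<Sum>l=1..n. (b l / a l)\<^sup>2 * X l ^ 4) \<le> z"
  shows "inner (\<mu> - \<nu>) v
    \<le> \<alpha> * (C\<^sup>2 / 4 * (\<Sum>l\<in>I. (a l * b l)\<^sup>2) + (norm w)\<^sup>2) + 4 * C\<^sup>2 * \<delta> ^ 4 / \<alpha> ^ 3 * z"
proof -
  define D where "D = inner (\<mu> - \<nu>) v"
  define k where "k = norm (K v)"
  define P where "P = (\<Sum>l\<in>I. (a l * b l)\<^sup>2)"
  define \<theta> where "\<theta> = \<alpha> / (2 * \<delta>)"
  have \<theta>: "\<theta> > 0" using pos by (simp add: \<theta>_def)
  define Q where "Q = C\<^sup>2 * (\<theta>\<^sup>2 * P + z / \<theta>\<^sup>2)"
  have noise: "(\<Sum>l=1..n. \<delta> * X l * inner v (e l)) \<le> \<alpha> * D / 2 + \<delta> * sqrt Q * k" for n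
  proof -
    \<comment> \<open>\<open>B\<close> holds the coefficients that are not absorbed by the Bregman distance; which
      frequencies these are depends on the realization of the noise.\<close>
    define B where "B = {l \<in> {1..n}. l \<in> I \<or> \<bar>X l\<bar> > \<theta> * a l}"
    have B: "finite B" "B \<subseteq> {1..}" by (auto simp: B_def)
    obtain W where W: "Kadj W = (\<Sum>l\<in>B. X l *\<^sub>R e l)"
        and W_norm: "(norm W)\<^sup>2 \<le> C\<^sup>2 * (\<Sum>l\<in>B. (b l * X l)\<^sup>2)"
      using stable[OF B] by blast
    have "(\<Sum>l\<in>B. (b l * X l)\<^sup>2)
        \<le> (\<Sum>l\<in>B. (if l \<in> I then \<theta>\<^sup>2 * (a l * b l)\<^sup>2 else 0) + (b l / a l)\<^sup>2 * X l ^ 4 / \<theta>\<^sup>2)"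
    proof (rule sum_mono)
      fix l assume l: "l \<in> B"
      define c where "c = (\<theta> * a l)\<^sup>2"
      have al: "a l > 0" using l a by (auto simp: B_def)
      have c: "c > 0" using al \<theta> by (simp add: c_def)
      have "(X l)\<^sup>2 \<le> (if l \<in> I then c else 0) + X l ^ 4 / c"
      proof (cases "l \<in> I")
        case True
        then show ?thesis using square_le_trade_off[OF c] by simp
      next
        case False
        then have "\<bar>\<theta> * a l\<bar> \<le> \<bar>X l\<bar>" using l al \<theta> by (simp add: B_def)
        then have "c \<le> (X l)\<^sup>2" unfolding c_def by (rule power2_mono)
        then have "c * (X l)\<^sup>2 \<le> (X l)\<^sup>2 * (X l)\<^sup>2" by (intro mult_right_mono) auto
        then show ?thesis using c False by (simp add: field_simps power_numeral_reduce)
      qed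
      then have "(b l)\<^sup>2 * (X l)\<^sup>2 \<le> (b l)\<^sup>2 * ((if l \<in> I then c else 0) + X l ^ 4 / c)"
        by (rule mult_left_mono) simp
      also have "\<dots> = (if l \<in> I then \<theta>\<^sup>2 * (a l * b l)\<^sup>2 else 0) + (b l / a l)\<^sup>2 * X l ^ 4 / \<theta>\<^sup>2"
        using al \<theta> by (simp add: c_def power_mult_distrib power_divide field_simps)
      finally show "(b l * X l)\<^sup>2 \<le> \<dots>" by (simp add: power_mult_distrib)
    qed
    also have "\<dots> = (\<Sum>l\<in>B. if l \<in> I then \<theta>\<^sup>2 * (a l * b l)\<^sup>2 else 0)
        + (\<Sum>l\<in>B. (b l / a l)\<^sup>2 * X l ^ 4) / \<theta>\<^sup>2"
      by (simp add: sum.distrib sum_divide_distrib)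
    also have "(\<Sum>l\<in>B. if l \<in> I then \<theta>\<^sup>2 * (a l * b l)\<^sup>2 else 0) = (\<Sum>l\<in>B \<inter> I. \<theta>\<^sup>2 * (a l * b l)\<^sup>2)"
      using B(1) by (simp add: sum.inter_restrict)
    also have "\<dots> \<le> \<theta>\<^sup>2 * P"
      unfolding P_def sum_distrib_left using I by (intro sum_mono2) auto
    also have "(\<Sum>l\<in>B. (b l / a l)\<^sup>2 * X l ^ 4) \<le> (\<Sum>l=1..n. (b l / a l)\<^sup>2 * X l ^ 4)"
      by (intro sum_mono2) (auto simp: B_def)
    also have "\<dots> \<le> z" by (rule z)
    finally have "(\<Sum>l\<in>B. (b l * X l)\<^sup>2) \<le> \<theta>\<^sup>2 * P + z / \<theta>\<^sup>2"
      by (simp add: divide_right_mono)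
    then have "(norm W)\<^sup>2 \<le> Q"
      unfolding Q_def by (rule order_trans[OF W_norm mult_left_mono]) simp
    then have "norm W \<le> sqrt Q" by (rule real_le_rsqrt)
    have low: "(\<Sum>l\<in>B. \<delta> * X l * inner v (e l)) \<le> \<delta> * sqrt Q * k"
    proof -
      have "(\<Sum>l\<in>B. \<delta> * X l * inner v (e l)) = \<delta> * inner v (Kadj W)"
        by (simp add: W inner_sum_right sum_distrib_left mult.assoc)
      also have "\<dots> = \<delta> * inner (K v) W" by (simp add: adjoint)
      also have "\<dots> \<le> \<delta> * (k * norm W)"
        using pos norm_cauchy_schwarz[of "K v" W] by (simp add: k_def)
      also have "\<dots> \<le> \<delta> * (k * sqrt Q)"
        using pos \<open>norm W \<le> sqrt Q\<close> by (intro mult_left_mono) (auto simp: k_def)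
      finally show ?thesis by (simp add: mult_ac)
    qed
    have "(\<Sum>l\<in>{1..n} - B. \<delta> * X l * inner v (e l)) \<le> (\<Sum>l\<in>{1..n} - B. \<alpha> / 2 * (a l * \<bar>inner v (e l)\<bar>))"
    proof (rule sum_mono)
      fix l assume l: "l \<in> {1..n} - B"
      have "X l * inner v (e l) \<le> \<bar>X l\<bar> * \<bar>inner v (e l)\<bar>"
        by (metis abs_ge_self abs_mult)
      also have "\<dots> \<le> \<theta> * a l * \<bar>inner v (e l)\<bar>"
        using l by (intro mult_right_mono) (auto simp: B_def)
      finally have "\<delta> * (X l * inner v (e l)) \<le> \<delta> * (\<theta> * a l * \<bar>inner v (e l)\<bar>)"
        using pos by (intro mult_left_mono) auto
      also have "\<dots> = \<alpha> / 2 * (a l * \<bar>inner v (e l)\<bar>)"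
        using pos by (simp add: \<theta>_def)
      finally show "\<delta> * X l * inner v (e l) \<le> \<dots>" by (simp add: mult.assoc)
    qed
    also have "\<dots> \<le> (\<Sum>l\<in>{1..n} - I. \<alpha> / 2 * (a l * \<bar>inner v (e l)\<bar>))"
      using pos a by (intro sum_mono2) (auto simp: B_def less_imp_le)
    also have "\<dots> \<le> \<alpha> / 2 * D"
      unfolding sum_distrib_left[symmetric] D_def using dominates pos by (intro mult_left_mono) auto
    finally have high: "(\<Sum>l\<in>{1..n} - B. \<delta> * X l * inner v (e l)) \<le> \<alpha> * D / 2" by simp
    have "(\<Sum>l=1..n. \<delta> * X l * inner v (e l))
        = (\<Sum>l\<in>{1..n} - B. \<delta> * X l * inner v (e l)) + (\<Sum>l\<in>B. \<delta> * X l * inner v (e l))"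
      by (rule sum.subset_diff) (auto simp: B_def)
    with high low show ?thesis by simp
  qed
  \<comment> \<open>The noise need not pair with \<open>v\<close> as an infinite sum a priori: convergence of its partial
    sums is read off from the optimality condition, all other terms of which lie in the space.\<close>
  have "(\<lambda>n. \<alpha> * (\<Sum>l=1..n. inner (\<mu> - \<nu>) (e l) * inner v (e l))
      + (\<Sum>l=1..n. inner (Kadj (K v)) (e l) * inner v (e l))
      + \<alpha> * (\<Sum>l=1..n. inner \<nu> (e l) * inner v (e l)))
      \<longlonglongrightarrow> \<alpha> * inner (\<mu> - \<nu>) v + inner (Kadj (K v)) v + \<alpha> * inner \<nu> v"
    by (intro tendsto_intros parseval_tendsto)
  moreover have "\<alpha> * (\<Sum>l=1..n. inner (\<mu> - \<nu>) (e l) * inner v (e l))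
      + (\<Sum>l=1..n. inner (Kadj (K v)) (e l) * inner v (e l))
      + \<alpha> * (\<Sum>l=1..n. inner \<nu> (e l) * inner v (e l)) = (\<Sum>l=1..n. \<delta> * X l * inner v (e l))" for n
    unfolding sum_distrib_left sum.distrib[symmetric]
  proof (rule sum.cong)
    fix l assume "l \<in> {1..n}"
    moreover have "inner (K (e l)) (K v) = inner (Kadj (K v)) (e l)"
      by (metis adjoint inner_commute)
    ultimately have "\<delta> * X l = inner (Kadj (K v)) (e l) + \<alpha> * inner \<mu> (e l)"
      using optimality[of l] by simp
    then show "\<alpha> * (inner (\<mu> - \<nu>) (e l) * inner v (e l)) + inner (Kadj (K v)) (e l) * inner v (e l)
        + \<alpha> * (inner \<nu> (e l) * inner v (e l)) = \<delta> * X l * inner v (e l)"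
      by (simp add: inner_diff_left algebra_simps)
  qed simp
  ultimately have "(\<lambda>n. \<Sum>l=1..n. \<delta> * X l * inner v (e l))
      \<longlonglongrightarrow> \<alpha> * D + inner (Kadj (K v)) v + \<alpha> * inner \<nu> v"
    by (simp add: D_def)
  then have "\<alpha> * D + inner (Kadj (K v)) v + \<alpha> * inner \<nu> v \<le> \<alpha> * D / 2 + \<delta> * sqrt Q * k"
    by (rule LIMSEQ_le_const2) (use noise in auto)
  moreover have "inner (Kadj (K v)) v = k\<^sup>2"
    using adjoint[of v "K v"] by (simp add: k_def power2_norm_eq_inner inner_commute)
  moreover have "- inner \<nu> v \<le> norm w * k"
    using Cauchy_Schwarz_ineq2[of "K v" w] adjoint[of v w] source
    by (simp add: k_def inner_commute mult.commute)
  then have "- (\<alpha> * inner \<nu> v) \<le> \<alpha> * (norm w * k)"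
    using pos mult_left_mono[of "- inner \<nu> v" "norm w * k" \<alpha>] by simp
  ultimately have "\<alpha> * D / 2 \<le> (\<delta> * sqrt Q + \<alpha> * norm w) * k - k\<^sup>2"
    by (simp add: algebra_simps)
  also have "\<dots> \<le> ((\<delta> * sqrt Q)\<^sup>2 + (\<alpha> * norm w)\<^sup>2) / 2"
  proof -
    have "p * k - k\<^sup>2 \<le> p\<^sup>2 / 4" for p
      using zero_le_power2[of "p / 2 - k"] by (simp add: power2_diff power_divide)
    moreover have "(p + q)\<^sup>2 / 4 \<le> (p\<^sup>2 + q\<^sup>2) / 2" for p q :: real
      using sum_squares_bound[of p q] by (simp add: power2_sum)
    ultimately show ?thesis using order_trans by blast
  qed
  also have "0 \<le> Q"
  proof -
    have "0 \<le> z" using z[of 0] by simp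
    moreover have "0 \<le> P" by (simp add: P_def sum_nonneg)
    ultimately show ?thesis by (simp add: Q_def)
  qed
  then have "(\<delta> * sqrt Q)\<^sup>2 = \<delta>\<^sup>2 * Q"
    by (simp add: power_mult_distrib)
  also have "\<delta>\<^sup>2 * Q = C\<^sup>2 * (\<alpha>\<^sup>2 / 4 * P + 4 * \<delta> ^ 4 / \<alpha>\<^sup>2 * z)"
    using pos by (simp add: Q_def \<theta>_def field_simps power_divide power_numeral_reduce)
  finally have "\<alpha> * D \<le> C\<^sup>2 * (\<alpha>\<^sup>2 / 4 * P + 4 * \<delta> ^ 4 / \<alpha>\<^sup>2 * z) + (\<alpha> * norm w)\<^sup>2"
    by simp
  also have "\<dots> = \<alpha> * (\<alpha> * (C\<^sup>2 / 4 * P + (norm w)\<^sup>2) + 4 * C\<^sup>2 * \<delta> ^ 4 / \<alpha> ^ 3 * z)"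
    using pos by (simp add: field_simps power_numeral_reduce)
  finally show ?thesis
    using pos by (simp add: D_def P_def)
qed

end

section \<open>Test functions and regular distributions\<close>

lemma deriv_funpow_lincomb:
  assumes "smooth f" "smooth g"
  shows "(deriv ^^ n) (\<lambda>x. a * f x + b * g x) = (\<lambda>x. a * (deriv ^^ n) f x + b * (deriv ^^ n) g x)"
proof (induction n)
  case (Suc n)
  have "deriv (\<lambda>x. a * (deriv ^^ n) f x + b * (deriv ^^ n) g x) x
      = a * deriv ((deriv ^^ n) f) x + b * deriv ((deriv ^^ n) g) x" for x
    using assms unfolding smooth_def
    by (intro DERIV_imp_deriv DERIV_add DERIV_cmult DERIV_deriv_iff_real_differentiable[THEN iffD2]) auto
  then show ?case by (simp add: Suc)
qed simp

lemma smooth_lincomb: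
  assumes "smooth f" "smooth g"
  shows "smooth (\<lambda>x. a * f x + b * g x)"
  using assms unfolding smooth_def deriv_funpow_lincomb[OF assms]
  by (auto intro!: derivative_intros)

lemma smooth_continuous_on: "smooth f \<Longrightarrow> continuous_on A f"
  unfolding smooth_def
  by (metis (no_types, lifting) continuous_at_imp_continuous_on differentiable_imp_continuous_within funpow_0)

lemma test_functions_lincomb:
  assumes "f \<in> test_functions" "g \<in> test_functions"
  shows "(\<lambda>x. a * f x + b * g x) \<in> test_functions"
  using assms by (auto simp: test_functions_def smooth_lincomb)

lemma test_functions_zero: "(\<lambda>_. 0) \<in> test_functions"
proof -
  have "(deriv ^^ n) (\<lambda>_::real. 0::real) = (\<lambda>_. 0)" for n by (induction n) auto
  then show ?thesis by (simp add: test_functions_def smooth_def)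
qed

text \<open>White noise is only given as a family of Gaussian variables, one for each test function. Closure
  under linear combinations is what makes finite sums of these variables Gaussian again.\<close>

lemma test_functions_sum:
  assumes "finite B" "\<And>i. i \<in> B \<Longrightarrow> f i \<in> test_functions"
  shows "(\<lambda>x. \<Sum>i\<in>B. c i * f i x) \<in> test_functions"
  using assms
proof (induction B rule: finite_induct)
  case (insert i B)
  then have "(\<lambda>x. c i * f i x + 1 * (\<Sum>i\<in>B. c i * f i x)) \<in> test_functions"
    by (intro test_functions_lincomb) auto
  then show ?case using insert by simp
qed (simp add: test_functions_zero)

lemma distribution_lincomb:
  "distribution T \<Longrightarrow> f \<in> test_functions \<Longrightarrow> g \<in> test_functions \<Longrightarrow>
    T (\<lambda>x. a * f x + b * g x) = a * T f + b * T g"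
  by (auto simp: distribution_def)

lemma distribution_sum:
  assumes T: "distribution T" and "finite B" "\<And>i. i \<in> B \<Longrightarrow> f i \<in> test_functions"
  shows "T (\<lambda>x. \<Sum>i\<in>B. c i * f i x) = (\<Sum>i\<in>B. c i * T (f i))"
  using assms(2,3)
proof (induction B rule: finite_induct)
  case empty
  then show ?case
    using distribution_lincomb[OF T test_functions_zero test_functions_zero, of 0 0] by simp
next
  case (insert i B)
  then have "T (\<lambda>x. c i * f i x + 1 * (\<Sum>i\<in>B. c i * f i x)) = c i * T (f i) + 1 * T (\<lambda>x. \<Sum>i\<in>B. c i * f i x)"
    by (intro distribution_lincomb T test_functions_sum) auto
  then show ?case using insert by simp
qed

lemma finite_measure_torus: "finite_measure torus" and measure_torus: "measure torus (space torus) = 1"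
proof -
  have "emeasure torus (space torus) = 1"
    unfolding torus_def by (subst emeasure_restrict_space) (auto simp: space_restrict_space)
  then show "finite_measure torus" "measure torus (space torus) = 1"
    by (auto intro!: finite_measureI simp: measure_def)
qed

text \<open>The bound by the supremum makes every square integrable function a distribution of order zero.\<close>

lemma square_integrable_test:
  assumes "f \<in> test_functions"
  shows "square_integrable f" and "norm (L2_class f) \<le> (SUP x\<in>{0..1}. \<bar>f x\<bar>)"
proof -
  define S where "S = (SUP x\<in>{0..1}. \<bar>f x\<bar>)"
  have cont: "continuous_on A f" for A
    using assms by (simp add: test_functions_def smooth_continuous_on)
  then have meas: "f \<in> borel_measurable torus"
    unfolding torus_def by (intro measurable_restrict_space1) (auto intro: borel_measurable_continuous_onI)
  have "bounded ((\<lambda>x. \<bar>f x\<bar>) ` {0..1})"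
    by (intro compact_imp_bounded compact_continuous_image continuous_intros cont compact_Icc)
  then have S: "\<bar>f x\<bar> \<le> S" if "x \<in> {0..1}" for x
    unfolding S_def using that by (intro cSUP_upper bounded_imp_bdd_above)
  have "\<bar>f 0\<bar> \<le> S" by (rule S) simp
  then have S0: "0 \<le> S" by linarith
  have bound: "(f x)\<^sup>2 \<le> S\<^sup>2" if "x \<in> space torus" for x
    using S[of x] that S0 by (auto simp: torus_def space_restrict_space abs_le_square_iff[symmetric])
  interpret finite_measure torus by (rule finite_measure_torus)
  have int: "integrable torus (\<lambda>x. (f x)\<^sup>2)"
    using meas bound by (intro integrable_const_bound[where B = "S\<^sup>2"]) auto
  with meas show sq: "square_integrable f" by (simp add: square_integrable_def)
  have "(norm (L2_class f))\<^sup>2 = (\<integral>x. f x * f x \<partial>torus)"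
    using sq by (simp add: power2_norm_eq_inner inner_L2_torus.abs_eq)
  also have "\<dots> \<le> (\<integral>x. S\<^sup>2 \<partial>torus)"
    using int bound by (intro integral_mono) (auto simp: power2_eq_square)
  also have "\<dots> = S\<^sup>2" by (simp add: measure_torus)
  finally show "norm (L2_class f) \<le> (SUP x\<in>{0..1}. \<bar>f x\<bar>)"
    using S0 unfolding S_def[symmetric] by (rule power2_le_imp_le)
qed

lemma L2_class_lincomb:
  assumes "f \<in> test_functions" "g \<in> test_functions"
  shows "L2_class (\<lambda>x. a * f x + b * g x) = a *\<^sub>R L2_class f + b *\<^sub>R L2_class g"
  using assms[THEN square_integrable_test(1)]
  by (simp add: plus_L2_torus.abs_eq scaleR_L2_torus.abs_eq square_integrable_scale)

lemma L2_class_sum: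
  assumes "finite B" "\<And>i. i \<in> B \<Longrightarrow> f i \<in> test_functions"
  shows "L2_class (\<lambda>x. \<Sum>i\<in>B. c i * f i x) = (\<Sum>i\<in>B. c i *\<^sub>R L2_class (f i))"
  using assms
proof (induction B rule: finite_induct)
  case empty
  then show ?case by (simp add: zero_L2_torus_def)
next
  case (insert i B)
  then have "L2_class (\<lambda>x. c i * f i x + 1 * (\<Sum>i\<in>B. c i * f i x))
      = c i *\<^sub>R L2_class (f i) + 1 *\<^sub>R L2_class (\<lambda>x. \<Sum>i\<in>B. c i * f i x)"
    by (intro L2_class_lincomb test_functions_sum) auto
  then show ?case using insert by simp
qed

lemma distribution_dist_of: "distribution (dist_of f)"
  unfolding distribution_def
proof (intro conjI ballI allI)
  fix \<phi> \<eta> :: "real \<Rightarrow> real" and a b :: real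
  assume "\<phi> \<in> test_functions" "\<eta> \<in> test_functions"
  then show "dist_of f (\<lambda>x. a * \<phi> x + b * \<eta> x) = a * dist_of f \<phi> + b * dist_of f \<eta>"
    by (simp add: dist_of_def L2_class_lincomb inner_add_right)
next
  have "\<bar>dist_of f \<phi>\<bar> \<le> norm f * (\<Sum>j\<le>(0::nat). SUP x\<in>{0..1}. \<bar>(deriv ^^ j) \<phi> x\<bar>)"
    if "\<phi> \<in> test_functions" for \<phi>
  proof -
    have "\<bar>dist_of f \<phi>\<bar> \<le> norm f * norm (L2_class \<phi>)"
      unfolding dist_of_def by (rule Cauchy_Schwarz_ineq2)
    also have "\<dots> \<le> norm f * (SUP x\<in>{0..1}. \<bar>\<phi> x\<bar>)"
      by (intro mult_left_mono square_integrable_test that norm_ge_zero)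
    finally show ?thesis by simp
  qed
  then show "\<exists>m C. \<forall>\<phi>\<in>test_functions. \<bar>dist_of f \<phi>\<bar> \<le> C * (\<Sum>j\<le>m. SUP x\<in>{0..1}. \<bar>(deriv ^^ j) \<phi> x\<bar>)"
    by blast
qed

section \<open>Besov norms and smoothing operators in wavelet coordinates\<close>

locale wavelets =
  fixes \<psi> :: "nat \<Rightarrow> real \<Rightarrow> real"
  assumes basis: "wavelet_basis \<psi>"
begin

abbreviation e :: "nat \<Rightarrow> L2_torus" where
  "e l \<equiv> L2_class (\<psi> l)"

lemma test: "l \<ge> 1 \<Longrightarrow> \<psi> l \<in> test_functions"
  using basis by (simp add: wavelet_basis_def)

sublocale orthonormal_basis e
  using basis by unfold_locales (auto simp: wavelet_basis_def)

lemma pairing_dist_of: "pairing \<psi> (dist_of f) (dist_of g) = inner f g"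
  unfolding pairing_def dist_of_def by (rule infsumI) (rule parseval)

lemma besov_term_two: "besov_term \<psi> 2 r T = (\<lambda>l. real l powr (2 * r) * (T (\<psi> l))\<^sup>2)"
  by (simp add: besov_term_def fun_eq_iff algebra_simps)

lemma besov_norm_two: "besov_norm \<psi> 2 r T = sqrt (\<Sum>\<^sub>\<infinity>l\<in>{1..}. real l powr (2 * r) * (T (\<psi> l))\<^sup>2)"
  unfolding besov_norm_def besov_term_two by (intro powr_half_sqrt infsum_nonneg) auto

lemma besov_two_finite_sum:
  assumes "finite B" "B \<subseteq> {1..}" "\<And>l. l \<ge> 1 \<Longrightarrow> T (\<psi> l) = (if l \<in> B then c l else 0)"
  shows "besov_term \<psi> 2 r T summable_on {1..}"
    and "besov_norm \<psi> 2 r T = sqrt (\<Sum>l\<in>B. real l powr (2 * r) * (c l)\<^sup>2)"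
proof -
  have "(besov_term \<psi> 2 r T has_sum (\<Sum>l\<in>B. real l powr (2 * r) * (c l)\<^sup>2)) {1..}"
    using assms unfolding besov_term_two
    by (intro has_sum_finite_neutralI) (auto intro!: sum.cong)
  then show "besov_term \<psi> 2 r T summable_on {1..}"
    and "besov_norm \<psi> 2 r T = sqrt (\<Sum>l\<in>B. real l powr (2 * r) * (c l)\<^sup>2)"
    by (auto simp: summable_on_def besov_norm_two besov_term_two infsumI)
qed

lemma besov_two_zero:
  "dist_of f \<in> besov_space \<psi> 2 0" "besov_norm \<psi> 2 0 (dist_of f) = norm f"
proof -
  have "((\<lambda>l. real l powr (2 * 0) * (dist_of f (\<psi> l))\<^sup>2) has_sum inner f f) {1..}"
    by (rule has_sum_cong[THEN iffD2, OF _ parseval]) (simp add: dist_of_def power2_eq_square)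
  then show "dist_of f \<in> besov_space \<psi> 2 0" "besov_norm \<psi> 2 0 (dist_of f) = norm f"
    by (auto simp: besov_space_def besov_norm_two besov_term_two infsumI summable_on_def
        norm_eq_sqrt_inner distribution_dist_of)
qed

end

locale smoothing_operator = wavelets \<psi> for \<psi> +
  fixes K Kadj :: "L2_torus \<Rightarrow> L2_torus" and t C :: real
  assumes adjoint: "inner (K f) g = inner f (Kadj g)"
    and C: "C > 0"
    and smoothing: "smoothing_with \<psi> t C (transposed \<psi> Kadj)"
    and smoothing_adj: "smoothing_with \<psi> t C (transposed \<psi> K)"
begin

lemma transposed_dist_of:
  "transposed \<psi> Kadj (dist_of f) (\<psi> l) = inner (K f) (e l)"
  "transposed \<psi> K (dist_of f) (\<psi> l) = inner (Kadj f) (e l)"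
  unfolding transposed_def pairing_dist_of by (metis adjoint inner_commute)+

text \<open>The smoothing property at \<open>r = 0\<close>: the range of \<open>K\<close> lies in \<open>B\<^sub>2\<^sup>t\<close>.\<close>

lemma range_smooth: "(\<lambda>m. real m powr (2 * t) * (inner (K f) (e m))\<^sup>2) summable_on {1..}"
proof -
  have "transposed \<psi> Kadj (dist_of f) \<in> besov_space \<psi> 2 (t + 0)"
    using smoothing besov_two_zero(1)[of f] unfolding smoothing_with_def by blast
  then show ?thesis
    by (simp add: besov_space_def besov_term_two transposed_dist_of)
qed

text \<open>The upper smoothing bound at \<open>r = - t\<close>, where the norm of a basis element is \<open>l powr (- t)\<close>.\<close>

lemma norm_image_basis:
  assumes "l \<ge> 1"
  shows "norm (K (e l)) \<le> C * real l powr (- t)"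
proof -
  have coeff: "dist_of (e l) (\<psi> m) = (if m \<in> {l} then 1 else 0)" if "m \<ge> 1" for m
    using that assms by (simp add: dist_of_def orthonormal)
  have "dist_of (e l) \<in> besov_space \<psi> 2 (- t)"
    using besov_two_finite_sum(1)[OF _ _ coeff] assms by (simp add: besov_space_def distribution_dist_of)
  then have "besov_norm \<psi> 2 (t + - t) (transposed \<psi> Kadj (dist_of (e l))) \<le> C * besov_norm \<psi> 2 (- t) (dist_of (e l))"
    using smoothing unfolding smoothing_with_def by blast
  also have "besov_norm \<psi> 2 (- t) (dist_of (e l)) = sqrt (real l powr (2 * (- t)))"
    using besov_two_finite_sum(2)[OF _ _ coeff] assms by simp
  also have "\<dots> = real l powr (- t)"
    by (rule real_sqrt_unique) (simp_all add: power2_eq_square flip: powr_add)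
  also have "besov_norm \<psi> 2 (t + - t) (transposed \<psi> Kadj (dist_of (e l))) = besov_norm \<psi> 2 0 (dist_of (K (e l)))"
    by (simp add: besov_norm_two transposed_dist_of dist_of_def)
  finally show ?thesis by (simp add: besov_two_zero)
qed

lemma adjoint_sum:
  assumes "\<And>l. l \<in> B \<Longrightarrow> Kadj (w l) = f l"
  shows "Kadj (\<Sum>l\<in>B. c l *\<^sub>R w l) = (\<Sum>l\<in>B. c l *\<^sub>R f l)"
proof -
  have "inner g (Kadj (\<Sum>l\<in>B. c l *\<^sub>R w l)) = inner g (\<Sum>l\<in>B. c l *\<^sub>R f l)" for g
    using assms by (simp add: inner_sum_right flip: adjoint) (simp add: adjoint)
  then show ?thesis by (rule vector_eq_ldot[THEN iffD1, OF allI])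
qed

text \<open>The lower smoothing bound for the adjoint at \<open>r = 0\<close>. It quantifies the cost of representing a
  combination of basis elements as a source element.\<close>

lemma norm_source_le:
  assumes B: "finite B" "B \<subseteq> {1..}" and W: "Kadj W = (\<Sum>l\<in>B. c l *\<^sub>R e l)"
  shows "(norm W)\<^sup>2 \<le> C\<^sup>2 * (\<Sum>l\<in>B. (real l powr t * c l)\<^sup>2)"
proof -
  have coeff: "transposed \<psi> K (dist_of W) (\<psi> l) = (if l \<in> B then c l else 0)" if "l \<ge> 1" for l
    using that B by (simp add: transposed_dist_of W inner_sum_basis)
  have "1 / C * besov_norm \<psi> 2 0 (dist_of W) \<le> besov_norm \<psi> 2 (t + 0) (transposed \<psi> K (dist_of W))"
    using smoothing_adj besov_two_zero(1)[of W] unfolding smoothing_with_def by blast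
  also have "\<dots> = sqrt (\<Sum>l\<in>B. real l powr (2 * t) * (c l)\<^sup>2)"
    using besov_two_finite_sum(2)[OF B coeff] by simp
  also have "(\<Sum>l\<in>B. real l powr (2 * t) * (c l)\<^sup>2) = (\<Sum>l\<in>B. (real l powr t * c l)\<^sup>2)"
    by (simp add: power2_eq_square mult_ac flip: powr_add)
  finally have "norm W \<le> C * sqrt (\<Sum>l\<in>B. (real l powr t * c l)\<^sup>2)"
    using C by (simp add: besov_two_zero field_simps)
  then have "(norm W)\<^sup>2 \<le> (C * sqrt (\<Sum>l\<in>B. (real l powr t * c l)\<^sup>2))\<^sup>2"
    by (rule power_mono) simp
  then show ?thesis by (simp add: power_mult_distrib sum_nonneg)
qed

lemma source_sum:
  assumes "\<forall>l\<ge>1. \<exists>w. Kadj w = e l" and "B \<subseteq> {1..}"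
  shows "\<exists>W. Kadj W = (\<Sum>l\<in>B. c l *\<^sub>R e l)"
proof -
  obtain w where "\<And>l. l \<ge> 1 \<Longrightarrow> Kadj (w l) = e l"
    using assms(1) by metis
  then have "Kadj (\<Sum>l\<in>B. c l *\<^sub>R w l) = (\<Sum>l\<in>B. c l *\<^sub>R e l)"
    using assms(2) by (intro adjoint_sum) auto
  then show ?thesis by blast
qed

end

section \<open>Moments of white noise\<close>

text \<open>By monotone convergence a series of nonnegative random variables with summable expectations has an
  integrable sum. The conclusion bounds the finite sums by a real variable, so that later
  pointwise estimates stay within the reals.\<close>

lemma nonneg_series_dominated:
  fixes f :: "nat \<Rightarrow> 'w \<Rightarrow> real"
  assumes [measurable]: "\<And>l. f l \<in> borel_measurable M" and nonneg: "\<And>l \<omega>. 0 \<le> f l \<omega>"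
    and bound: "\<And>l. (\<integral>\<^sup>+\<omega>. ennreal (f l \<omega>) \<partial>M) \<le> ennreal (b l)"
    and b: "\<And>l. 0 \<le> b l" "summable b"
  shows "\<exists>Z. integrable M Z \<and> (AE \<omega> in M. \<forall>B. finite B \<longrightarrow> (\<Sum>l\<in>B. f l \<omega>) \<le> Z \<omega>)"
proof -
  define G where "G \<omega> = (\<Sum>l. ennreal (f l \<omega>))" for \<omega>
  have [measurable]: "G \<in> borel_measurable M" unfolding G_def by measurable
  have "(\<integral>\<^sup>+\<omega>. G \<omega> \<partial>M) = (\<Sum>l. \<integral>\<^sup>+\<omega>. ennreal (f l \<omega>) \<partial>M)"
    unfolding G_def by (rule nn_integral_suminf) measurable
  also have "\<dots> \<le> (\<Sum>l. ennreal (b l))"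
    by (intro suminf_le bound summableI)
  also have "\<dots> < \<infinity>"
    using b by (simp add: suminf_ennreal2)
  finally have fin: "(\<integral>\<^sup>+\<omega>. G \<omega> \<partial>M) < \<infinity>" .
  have "(\<integral>\<^sup>+\<omega>. ennreal (norm (enn2real (G \<omega>))) \<partial>M) \<le> (\<integral>\<^sup>+\<omega>. G \<omega> \<partial>M)"
    by (intro nn_integral_mono) (simp add: ennreal_enn2real_if)
  with fin have "integrable M (\<lambda>\<omega>. enn2real (G \<omega>))"
    by (auto simp: integrable_iff_bounded)
  moreover have "AE \<omega> in M. G \<omega> \<noteq> \<infinity>"
    using fin by (intro nn_integral_PInf_AE) auto
  then have "AE \<omega> in M. \<forall>B. finite B \<longrightarrow> (\<Sum>l\<in>B. f l \<omega>) \<le> enn2real (G \<omega>)"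
  proof eventually_elim
    case (elim \<omega>)
    have "(\<Sum>l\<in>B. f l \<omega>) \<le> enn2real (G \<omega>)" if B: "finite B" for B
    proof -
      have "(\<Sum>l\<in>B. ennreal (f l \<omega>)) \<le> G \<omega>"
        unfolding G_def using B by (intro sum_le_suminf summableI) auto
      then have "ennreal (\<Sum>l\<in>B. f l \<omega>) \<le> ennreal (enn2real (G \<omega>))"
        using elim by (simp add: nonneg ennreal_enn2real_if)
      then show ?thesis by (simp add: ennreal_le_iff)
    qed
    then show ?case by blast
  qed
  ultimately show ?thesis by blast
qed

text \<open>Normality of the noise enters the rate through the fixed ratio of the fourth moment
  to the squared variance. A vanishing variable counts as Gaussian but has no density.\<close>

lemma centered_gaussian_moments:
  assumes "prob_space M" "centered_gaussian M X"
  shows "(\<integral>\<^sup>+\<omega>. ennreal ((X \<omega>)\<^sup>2) \<partial>M) = ennreal (\<integral>\<omega>. (X \<omega>)\<^sup>2 \<partial>M)"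
    and "(\<integral>\<^sup>+\<omega>. ennreal (X \<omega> ^ 4) \<partial>M) = ennreal (3 * (\<integral>\<omega>. (X \<omega>)\<^sup>2 \<partial>M)\<^sup>2)"
proof -
  have [measurable]: "X \<in> borel_measurable M"
    using assms(2) by (simp add: centered_gaussian_def)
  have "\<exists>v\<ge>0. (\<integral>\<^sup>+\<omega>. ennreal ((X \<omega>)\<^sup>2) \<partial>M) = ennreal v \<and>
      (\<integral>\<^sup>+\<omega>. ennreal (X \<omega> ^ 4) \<partial>M) = ennreal (3 * v\<^sup>2)"
  proof (cases "AE \<omega> in M. X \<omega> = 0")
    case True
    then have "(\<integral>\<^sup>+\<omega>. ennreal (X \<omega> ^ k) \<partial>M) = (\<integral>\<^sup>+\<omega>. 0 \<partial>M)" if "k > 0" for k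
      by (intro nn_integral_cong_AE) (auto simp: that elim: AE_mp)
    then show ?thesis by (intro exI[of _ 0]) simp
  next
    case False
    then obtain \<sigma> where \<sigma>: "\<sigma> > 0" and D: "distributed M lborel X (\<lambda>x. ennreal (normal_density 0 \<sigma> x))"
      using assms(2) by (auto simp: centered_gaussian_def)
    have moment: "(\<integral>\<^sup>+\<omega>. ennreal (X \<omega> ^ (2 * k)) \<partial>M) = ennreal (fact (2 * k) / ((2 / \<sigma>\<^sup>2) ^ k * fact k))" for k
    proof -
      have "(\<integral>\<^sup>+\<omega>. ennreal (X \<omega> ^ (2 * k)) \<partial>M) = (\<integral>\<^sup>+x. ennreal (normal_density 0 \<sigma> x) * ennreal (x ^ (2 * k)) \<partial>lborel)"
        by (subst distributed_nn_integral[OF D]) auto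
      also have "\<dots> = (\<integral>\<^sup>+x. ennreal (normal_density 0 \<sigma> x * (x - 0) ^ (2 * k)) \<partial>lborel)"
        by (simp add: ennreal_mult')
      also have "\<dots> = ennreal (fact (2 * k) / ((2 / \<sigma>\<^sup>2) ^ k * fact k))"
        using normal_moment_even[OF \<sigma>, of 0 k]
        by (subst nn_integral_eq_integral) (auto simp: has_bochner_integral_iff)
      finally show ?thesis .
    qed
    have "(\<integral>\<^sup>+\<omega>. ennreal ((X \<omega>)\<^sup>2) \<partial>M) = ennreal (\<sigma>\<^sup>2)"
      using moment[of 1] \<sigma> by simp
    moreover have "(\<integral>\<^sup>+\<omega>. ennreal (X \<omega> ^ 4) \<partial>M) = ennreal (3 * (\<sigma>\<^sup>2)\<^sup>2)"
      using moment[of 2] \<sigma> by (simp add: fact_numeral power_divide field_simps)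
    ultimately show ?thesis by (intro exI[of _ "\<sigma>\<^sup>2"]) simp
  qed
  then obtain v where v: "v \<ge> 0" "(\<integral>\<^sup>+\<omega>. ennreal ((X \<omega>)\<^sup>2) \<partial>M) = ennreal v"
      "(\<integral>\<^sup>+\<omega>. ennreal (X \<omega> ^ 4) \<partial>M) = ennreal (3 * v\<^sup>2)"
    by blast
  have "(\<integral>\<omega>. (X \<omega>)\<^sup>2 \<partial>M) = v"
    using v by (subst integral_eq_nn_integral) auto
  with v show "(\<integral>\<^sup>+\<omega>. ennreal ((X \<omega>)\<^sup>2) \<partial>M) = ennreal (\<integral>\<omega>. (X \<omega>)\<^sup>2 \<partial>M)"
    and "(\<integral>\<^sup>+\<omega>. ennreal (X \<omega> ^ 4) \<partial>M) = ennreal (3 * (\<integral>\<omega>. (X \<omega>)\<^sup>2 \<partial>M)\<^sup>2)"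
    by simp_all
qed

lemma white_noise_moments:
  assumes "white_noise M N" "\<phi> \<in> test_functions"
  shows "(\<lambda>\<omega>. N \<omega> \<phi>) \<in> borel_measurable M"
    and "(\<integral>\<^sup>+\<omega>. ennreal ((N \<omega> \<phi>)\<^sup>2) \<partial>M) = ennreal ((norm (L2_class \<phi>))\<^sup>2)"
    and "(\<integral>\<^sup>+\<omega>. ennreal (N \<omega> \<phi> ^ 4) \<partial>M) = ennreal (3 * norm (L2_class \<phi>) ^ 4)"
proof -
  have N: "prob_space M" "centered_gaussian M (\<lambda>\<omega>. N \<omega> \<phi>)"
    using assms by (auto simp: white_noise_def)
  have var: "(\<integral>\<omega>. (N \<omega> \<phi>)\<^sup>2 \<partial>M) = (norm (L2_class \<phi>))\<^sup>2"
    using assms by (simp add: white_noise_def power2_eq_square power2_norm_eq_inner[symmetric] dot_square_norm)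
  show "(\<lambda>\<omega>. N \<omega> \<phi>) \<in> borel_measurable M"
    using N(2) by (simp add: centered_gaussian_def)
  show "(\<integral>\<^sup>+\<omega>. ennreal ((N \<omega> \<phi>)\<^sup>2) \<partial>M) = ennreal ((norm (L2_class \<phi>))\<^sup>2)"
    using centered_gaussian_moments(1)[OF N] by (simp add: var)
  show "(\<integral>\<^sup>+\<omega>. ennreal (N \<omega> \<phi> ^ 4) \<partial>M) = ennreal (3 * norm (L2_class \<phi>) ^ 4)"
    using centered_gaussian_moments(2)[OF N] by (simp add: var flip: power_mult)
qed

context wavelets
begin

text \<open>White noise lies in the Besov space of order \<open>- t\<close> almost surely, because the expectation of the squared norm is
  the sum of \<open>l powr (- 2 * t)\<close>, and \<open>2 * t > 1\<close>.\<close>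

lemma white_noise_regularity:
  assumes N: "white_noise M N" and t: "t > 1/2"
  shows "AE \<omega> in M. (\<lambda>l. real l powr (- 2 * t) * (N \<omega> (\<psi> l))\<^sup>2) summable_on {1..}"
proof -
  \<comment> \<open>The value of the basis at index \<open>0\<close> is unspecified, so that term is removed to keep
    measurability.\<close>
  define f where "f l \<omega> = (if l = 0 then 0 else real l powr (- 2 * t) * (N \<omega> (\<psi> l))\<^sup>2)" for l \<omega>
  have "\<exists>Z. integrable M Z \<and> (AE \<omega> in M. \<forall>B. finite B \<longrightarrow> (\<Sum>l\<in>B. f l \<omega>) \<le> Z \<omega>)"
  proof (rule nonneg_series_dominated)
    fix l :: nat
    show "f l \<in> borel_measurable M"
      using white_noise_moments(1)[OF N test, of l] by (cases "l = 0") (auto simp: f_def[abs_def])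
    show "(\<integral>\<^sup>+\<omega>. ennreal (f l \<omega>) \<partial>M) \<le> ennreal (real l powr (- 2 * t))"
    proof (cases "l = 0")
      case False
      then have l: "l \<ge> 1" by simp
      have [measurable]: "(\<lambda>\<omega>. N \<omega> (\<psi> l)) \<in> borel_measurable M"
        by (rule white_noise_moments(1)[OF N test[OF l]])
      have "norm (e l) = 1"
        using l by (simp add: norm_eq_sqrt_inner orthonormal)
      then have "(\<integral>\<^sup>+\<omega>. ennreal ((N \<omega> (\<psi> l))\<^sup>2) \<partial>M) = 1"
        using white_noise_moments(2)[OF N test[OF l]] by simp
      then show ?thesis
        using False by (simp add: f_def ennreal_mult' nn_integral_cmult)
    qed (simp add: f_def)
    show "summable (\<lambda>l. real l powr (- 2 * t))"
      using t by (simp add: summable_real_powr_iff)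
  qed (auto simp: f_def)
  then obtain Z where "AE \<omega> in M. \<forall>B. finite B \<longrightarrow> (\<Sum>l\<in>B. f l \<omega>) \<le> Z \<omega>"
    by blast
  then show ?thesis
  proof eventually_elim
    case (elim \<omega>)
    have "(\<Sum>l\<in>B. real l powr (- 2 * t) * (N \<omega> (\<psi> l))\<^sup>2) \<le> Z \<omega>" if "B \<subseteq> {1..}" "finite B" for B
    proof -
      have "(\<Sum>l\<in>B. real l powr (- 2 * t) * (N \<omega> (\<psi> l))\<^sup>2) = (\<Sum>l\<in>B. f l \<omega>)"
        using that by (intro sum.cong) (auto simp: f_def)
      then show ?thesis using elim that by simp
    qed
    then show ?case
      by (intro nonneg_bdd_above_summable_on bdd_aboveI2[where M = "Z \<omega>"]) auto
  qed
qed

text \<open>The absolute convergence of the duality pairing between the orders \<open>t\<close> and \<open>- t\<close>.\<close>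

lemma weighted_product_summable:
  assumes "(\<lambda>l. real l powr (2 * t) * (x l)\<^sup>2) summable_on {1..}"
    and "(\<lambda>l. real l powr (- 2 * t) * (y l)\<^sup>2) summable_on {1..}"
  shows "(\<lambda>l. x l * y l :: real) summable_on {1..}"
proof -
  have "(\<lambda>l. norm ((real l powr t * x l) * (real l powr (- t) * y l))) summable_on {1..}"
  proof (rule abs_summable_product)
    have "(real l powr r * z) * (real l powr r * z) = real l powr (2 * r) * z\<^sup>2" for l r and z :: real
      by (simp add: power2_eq_square mult_ac flip: powr_add)
    then have "norm ((real l powr r * z) * (real l powr r * z)) = real l powr (2 * r) * z\<^sup>2" for l r and z :: real
      by (simp del: abs_mult_self_eq)
    from this[of _ t] this[of _ "- t"] show "(\<lambda>l. norm ((real l powr t * x l) * (real l powr t * x l))) summable_on {1..}"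
      and "(\<lambda>l. norm ((real l powr (- t) * y l) * (real l powr (- t) * y l))) summable_on {1..}"
      using assms by simp_all
  qed
  then have "(\<lambda>l. (real l powr t * x l) * (real l powr (- t) * y l)) summable_on {1..}"
    by (rule abs_summable_summable)
  moreover have "(real l powr t * x l) * (real l powr (- t) * y l) = x l * y l" if "l \<in> {1..}" for l
    using that by (simp add: powr_minus)
  ultimately show ?thesis
    by (rule summable_on_cong[THEN iffD1, rotated])
qed

text \<open>The pairing of white noise with \<open>f\<close> is the almost sure limit of its pairings with the
  projections of \<open>f\<close>. These projections are test functions, whose pairings are Gaussian with
  variance at most \<open>\<parallel>f\<parallel>\<^sup>2\<close>; Fatou's lemma carries the bound on the fourth moments over to the limit.
  The pairing itself is only almost everywhere equal to the measurable function \<open>g\<close>, since an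
  infinite sum is \<open>0\<close> by convention where it diverges.\<close>

lemma pairing_white_noise:
  assumes N: "white_noise M N" and t: "t > 1/2"
    and f: "(\<lambda>m. real m powr (2 * t) * (inner f (e m))\<^sup>2) summable_on {1..}"
  shows "\<exists>g\<in>borel_measurable M. (AE \<omega> in M. g \<omega> = pairing \<psi> (dist_of f) (N \<omega>)) \<and>
    (\<integral>\<^sup>+\<omega>. ennreal (g \<omega> ^ 4) \<partial>M) \<le> ennreal (3 * norm f ^ 4)"
proof -
  define Y where "Y n \<omega> = (\<Sum>m=1..n. inner f (e m) * N \<omega> (\<psi> m))" for n \<omega>
  define g where "g \<omega> = lim (\<lambda>n. Y n \<omega>)" for \<omega>
  have [measurable]: "Y n \<in> borel_measurable M" for n
    unfolding Y_def[abs_def]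
    by (intro borel_measurable_sum borel_measurable_times borel_measurable_const white_noise_moments(1)[OF N] test) auto
  then have [measurable]: "g \<in> borel_measurable M"
    unfolding g_def[abs_def] by measurable
  have Y: "(\<integral>\<^sup>+\<omega>. ennreal (Y n \<omega> ^ 4) \<partial>M) \<le> ennreal (3 * norm f ^ 4)" for n
  proof -
    define \<phi> where "\<phi> x = (\<Sum>m=1..n. inner f (e m) * \<psi> m x)" for x
    have \<phi>: "\<phi> \<in> test_functions"
      unfolding \<phi>_def[abs_def] by (intro test_functions_sum test) auto
    have "L2_class \<phi> = proj n f"
      unfolding \<phi>_def[abs_def] proj_def by (intro L2_class_sum test) auto
    then have "norm (L2_class \<phi>) \<le> norm f" by (simp add: norm_proj_le)
    then have "3 * norm (L2_class \<phi>) ^ 4 \<le> 3 * norm f ^ 4" by (simp add: power_mono)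
    moreover have "Y n \<omega> = N \<omega> \<phi>" if "\<omega> \<in> space M" for \<omega>
      unfolding \<phi>_def[abs_def] Y_def using N that
      by (intro distribution_sum[symmetric] test) (auto simp: white_noise_def)
    then have "(\<integral>\<^sup>+\<omega>. ennreal (Y n \<omega> ^ 4) \<partial>M) = (\<integral>\<^sup>+\<omega>. ennreal (N \<omega> \<phi> ^ 4) \<partial>M)"
      by (intro nn_integral_cong) simp
    ultimately show ?thesis
      by (simp add: white_noise_moments(3)[OF N \<phi>] ennreal_leI)
  qed
  have lim: "AE \<omega> in M. (\<lambda>n. Y n \<omega>) \<longlonglongrightarrow> pairing \<psi> (dist_of f) (N \<omega>)"
    using white_noise_regularity[OF N t]
  proof eventually_elim
    case (elim \<omega>)
    show ?case
      unfolding Y_def pairing_def dist_of_def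
      by (intro has_sum_partial_sums has_sum_infsum weighted_product_summable[OF f elim])
  qed
  then have g: "AE \<omega> in M. g \<omega> = pairing \<psi> (dist_of f) (N \<omega>)"
    by eventually_elim (simp add: g_def limI)
  have "(\<integral>\<^sup>+\<omega>. ennreal (g \<omega> ^ 4) \<partial>M) = (\<integral>\<^sup>+\<omega>. liminf (\<lambda>n. ennreal (Y n \<omega> ^ 4)) \<partial>M)"
  proof (rule nn_integral_cong_AE)
    show "AE \<omega> in M. ennreal (g \<omega> ^ 4) = liminf (\<lambda>n. ennreal (Y n \<omega> ^ 4))"
      using g lim
    proof eventually_elim
      case (elim \<omega>)
      then have "(\<lambda>n. ennreal (Y n \<omega> ^ 4)) \<longlonglongrightarrow> ennreal (g \<omega> ^ 4)"
        by (intro tendsto_intros) simp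
      then show ?case by (intro lim_imp_Liminf[symmetric]) auto
    qed
  qed
  also have "\<dots> \<le> liminf (\<lambda>n. \<integral>\<^sup>+\<omega>. ennreal (Y n \<omega> ^ 4) \<partial>M)"
    by (rule nn_integral_liminf) measurable
  also have "\<dots> \<le> ennreal (3 * norm f ^ 4)"
    using Y by (intro Liminf_le) auto
  finally show ?thesis using g by (intro bexI[of _ g]) auto
qed

lemma white_noise_fourth_moment_series:
  assumes N: "white_noise M N" and t: "t > 1/2"
    and F: "\<And>l. (\<lambda>m. real m powr (2 * t) * (inner (F l) (e m))\<^sup>2) summable_on {1..}"
    and c: "\<And>l. 0 \<le> c l" "summable (\<lambda>l. c l * norm (F l) ^ 4)"
  shows "\<exists>Z. integrable M Z \<and>
    (AE \<omega> in M. \<forall>n. (\<Sum>l=1..n. c l * pairing \<psi> (dist_of (F l)) (N \<omega>) ^ 4) \<le> Z \<omega>)"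
proof -
  from pairing_white_noise[OF N t F] obtain g where [measurable]: "\<And>l. g l \<in> borel_measurable M"
    and g: "\<And>l. AE \<omega> in M. g l \<omega> = pairing \<psi> (dist_of (F l)) (N \<omega>)"
    and moment: "\<And>l. (\<integral>\<^sup>+\<omega>. ennreal (g l \<omega> ^ 4) \<partial>M) \<le> ennreal (3 * norm (F l) ^ 4)"
    by metis
  have "\<exists>Z. integrable M Z \<and> (AE \<omega> in M. \<forall>B. finite B \<longrightarrow> (\<Sum>l\<in>B. c l * g l \<omega> ^ 4) \<le> Z \<omega>)"
  proof (rule nonneg_series_dominated)
    fix l
    show "(\<integral>\<^sup>+\<omega>. ennreal (c l * g l \<omega> ^ 4) \<partial>M) \<le> ennreal (c l * (3 * norm (F l) ^ 4))"
      using c(1) moment by (simp add: ennreal_mult' nn_integral_cmult mult_left_mono)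
    show "summable (\<lambda>l. c l * (3 * norm (F l) ^ 4))"
      using summable_mult[OF c(2), of 3] by (simp add: mult_ac)
  qed (auto simp: c(1))
  then obtain Z where Z: "integrable M Z" "AE \<omega> in M. \<forall>B. finite B \<longrightarrow> (\<Sum>l\<in>B. c l * g l \<omega> ^ 4) \<le> Z \<omega>"
    by blast
  have "AE \<omega> in M. \<forall>l. g l \<omega> = pairing \<psi> (dist_of (F l)) (N \<omega>)"
    using g by (simp add: AE_all_countable)
  with Z(2) have "AE \<omega> in M. \<forall>n. (\<Sum>l=1..n. c l * pairing \<psi> (dist_of (F l)) (N \<omega>) ^ 4) \<le> Z \<omega>"
    by eventually_elim (metis (no_types, lifting) finite_atLeastAtMost sum.cong)
  with Z(1) show ?thesis by blast
qed

end

section \<open>The Besov penalty and its subgradients\<close>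

context wavelets
begin

definition supp :: "L2_torus \<Rightarrow> nat set" where
  "supp u = {l. l \<ge> 1 \<and> inner u (e l) \<noteq> 0}"

lemma supp_ge_1: "supp u \<subseteq> {1..}"
  by (auto simp: supp_def)

text \<open>The subgradient of the weighted \<open>l\<^sup>1\<close> norm that vanishes off the support.\<close>

definition sgn_subgradient :: "real \<Rightarrow> L2_torus \<Rightarrow> L2_torus" where
  "sgn_subgradient s u = (\<Sum>l\<in>supp u. (real l powr (s - 1/2) * sgn (inner u (e l))) *\<^sub>R e l)"

lemma inner_sgn_subgradient:
  "inner (sgn_subgradient s u) f = (\<Sum>l\<in>supp u. real l powr (s - 1/2) * sgn (inner u (e l)) * inner f (e l))"
  unfolding sgn_subgradient_def inner_sum_left by (simp add: inner_commute[of f])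

lemma inner_sgn_subgradient_le:
  "inner (sgn_subgradient s u) f \<le> (\<Sum>l\<in>supp u. real l powr (s - 1/2) * \<bar>inner f (e l)\<bar>)"
  unfolding inner_sgn_subgradient mult.assoc
  by (intro sum_mono mult_left_mono) (auto simp: sgn_if)

lemma besov_penalty_eq:
  "besov_penalty \<psi> s u =
    (if (\<lambda>l. real l powr (s - 1/2) * \<bar>inner u (e l)\<bar>) summable_on {1..}
     then ereal (\<Sum>\<^sub>\<infinity>l\<in>{1..}. real l powr (s - 1/2) * \<bar>inner u (e l)\<bar>) else \<infinity>)"
proof -
  have "besov_term \<psi> 1 s (dist_of u) = (\<lambda>l. real l powr (s - 1/2) * \<bar>inner u (e l)\<bar>)"
    by (simp add: besov_term_def dist_of_def fun_eq_iff)
  moreover have "0 \<le> (\<Sum>\<^sub>\<infinity>l\<in>{1..}. real l powr (s - 1/2) * \<bar>inner u (e l)\<bar>)"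
    by (intro infsum_nonneg) auto
  ultimately show ?thesis
    by (simp add: besov_penalty_def besov_space_def besov_norm_def distribution_dist_of)
qed

lemma besov_penalty_ge_sum:
  assumes "finite B" "B \<subseteq> {1..}"
  shows "ereal (\<Sum>l\<in>B. real l powr (s - 1/2) * \<bar>inner f (e l)\<bar>) \<le> besov_penalty \<psi> s f"
  using assms by (auto simp: besov_penalty_eq intro!: finite_sum_le_infsum)

lemma besov_penalty_finite_support:
  assumes "finite (supp u)"
  shows "besov_penalty \<psi> s u = ereal (inner (sgn_subgradient s u) u)"
proof -
  have "((\<lambda>l. real l powr (s - 1/2) * \<bar>inner u (e l)\<bar>) has_sum
      (\<Sum>l\<in>supp u. real l powr (s - 1/2) * \<bar>inner u (e l)\<bar>)) {1..}"
    using assms by (intro has_sum_finite_neutralI) (auto simp: supp_def)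
  moreover have "inner (sgn_subgradient s u) u = (\<Sum>l\<in>supp u. real l powr (s - 1/2) * \<bar>inner u (e l)\<bar>)"
    unfolding inner_sgn_subgradient by (intro sum.cong) (auto simp: sgn_if)
  ultimately show ?thesis
    by (auto simp: besov_penalty_eq infsumI summable_on_def)
qed

lemma sgn_subgradient_mem:
  assumes "finite (supp u)"
  shows "sgn_subgradient s u \<in> subdifferential (besov_penalty \<psi> s) u"
  unfolding subdifferential_def
proof (intro CollectI conjI allI)
  fix f
  have "besov_penalty \<psi> s u + ereal (inner (sgn_subgradient s u) (f - u)) = ereal (inner (sgn_subgradient s u) f)"
    by (simp add: besov_penalty_finite_support[OF assms] inner_diff_right)
  also have "\<dots> \<le> ereal (\<Sum>l\<in>supp u. real l powr (s - 1/2) * \<bar>inner f (e l)\<bar>)"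
    using inner_sgn_subgradient_le by simp
  also have "\<dots> \<le> besov_penalty \<psi> s f"
    by (rule besov_penalty_ge_sum[OF assms supp_ge_1])
  finally show "besov_penalty \<psi> s u + ereal (inner (sgn_subgradient s u) (f - u)) \<le> besov_penalty \<psi> s f" .
qed (simp add: besov_penalty_finite_support[OF assms])

text \<open>Sparsity of \<open>u\<close> makes the Bregman distance strong: by the subgradient inequality for \<open>\<mu>\<close> it is
  at least \<open>R U - \<langle>\<nu>, U\<rangle>\<close>, where \<open>\<nu>\<close> is the subgradient at \<open>u\<close>. On the support of \<open>u\<close> the terms of
  this difference are nonnegative, and off the support, where \<open>\<nu>\<close> and \<open>u\<close> vanish, they are the
  full weighted coefficients of \<open>U - u\<close>.\<close>

lemma bregman_dominates:
  assumes u: "finite (supp u)" and \<mu>: "\<mu> \<in> subdifferential (besov_penalty \<psi> s) U"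
  shows "(\<Sum>l\<in>{1..n} - supp u. real l powr (s - 1/2) * \<bar>inner (U - u) (e l)\<bar>)
    \<le> inner (\<mu> - sgn_subgradient s u) (U - u)"
proof -
  define a where "a l = real l powr (s - 1/2) * \<bar>inner U (e l)\<bar>" for l
  define \<nu> where "\<nu> = sgn_subgradient s u"
  have "besov_penalty \<psi> s U \<noteq> \<infinity>" and sub: "besov_penalty \<psi> s U + ereal (inner \<mu> (u - U)) \<le> besov_penalty \<psi> s u"
    using \<mu> by (auto simp: subdifferential_def)
  then obtain r where r: "besov_penalty \<psi> s U = ereal r"
    by (auto simp: besov_penalty_eq split: if_splits)
  have "(\<Sum>l\<in>{1..n} - supp u. real l powr (s - 1/2) * \<bar>inner (U - u) (e l)\<bar>) = sum a ({1..n} - supp u)"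
    by (intro sum.cong) (auto simp: a_def supp_def inner_diff_left)
  also have "\<dots> = sum a (({1..n} - supp u) \<union> supp u) - sum a (supp u)"
    using u by (subst sum.union_disjoint) auto
  also have "sum a (({1..n} - supp u) \<union> supp u) \<le> r"
    using u supp_ge_1 besov_penalty_ge_sum[of "({1..n} - supp u) \<union> supp u" s U]
    by (auto simp: a_def r)
  also have "r - sum a (supp u) \<le> r - inner \<nu> U"
    using inner_sgn_subgradient_le[of s u U] by (simp add: a_def \<nu>_def)
  also have "\<dots> \<le> inner (\<mu> - \<nu>) (U - u)"
    using sub by (simp add: r besov_penalty_finite_support[OF u] \<nu>_def inner_diff_left inner_diff_right)
  finally show ?thesis by (simp add: \<nu>_def)
qed

end

section \<open>The rate of convergence\<close>

context smoothing_operator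
begin

text \<open>The optimality condition tested with a basis element. Splitting the noise off the data needs the
  convergence of both series, hence the regularity of the realization \<open>n\<close> of the noise.\<close>

lemma optimality_coefficient:
  assumes sol: "regularized_solution \<psi> K R (data (K u) n \<delta>) \<alpha> U \<mu>" and l: "l \<ge> 1"
    and n: "(\<lambda>m. real m powr (- 2 * t) * (n (\<psi> m))\<^sup>2) summable_on {1..}"
  shows "inner (K (e l)) (K (U - u)) - \<delta> * pairing \<psi> (dist_of (K (e l))) n + \<alpha> * inner \<mu> (e l) = 0"
proof -
  have "((\<lambda>m. inner (K (e l)) (e m) * n (\<psi> m)) has_sum pairing \<psi> (dist_of (K (e l))) n) {1..}"
    unfolding pairing_def dist_of_def
    by (intro has_sum_infsum weighted_product_summable[OF range_smooth n])
  from has_sum_add[OF has_sum_add[OF parseval[of "K (e l)" "K U"] has_sum_uminusI[OF parseval[of "K (e l)" "K u"]]]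
      has_sum_cmult_right[OF this, of "- \<delta>"]]
  have "transposed \<psi> K (\<lambda>\<eta>. dist_of (K U) \<eta> - data (K u) n \<delta> \<eta>) (\<psi> l)
      = inner (K (e l)) (K U) + - inner (K (e l)) (K u) + - \<delta> * pairing \<psi> (dist_of (K (e l))) n"
    unfolding transposed_def pairing_def[of \<psi> _ "\<lambda>\<eta>. dist_of (K U) \<eta> - data (K u) n \<delta> \<eta>"]
    by (intro infsumI) (simp add: dist_of_def data_def algebra_simps)
  moreover have "inner (K (e l)) (K (U - u)) = inner (K (e l)) (K U) - inner (K (e l)) (K u)"
    by (metis adjoint inner_commute inner_diff_right)
  moreover have "transposed \<psi> K (\<lambda>\<eta>. dist_of (K U) \<eta> - data (K u) n \<delta> \<eta>) (\<psi> l) + \<alpha> * inner \<mu> (e l) = 0"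
    using sol test[OF l] by (simp add: regularized_solution_def dist_of_def)
  ultimately show ?thesis by simp
qed

text \<open>The constant \<open>A\<close> and the random variable \<open>Z\<close> depend neither on \<open>\<delta>\<close> and \<open>\<alpha>\<close> nor on the solution. With
  \<open>X\<^sub>l\<close> for the pairing of \<open>K (e l)\<close> with the noise, \<open>Z\<close> bounds a multiple of the sum of
  \<open>l powr (2 * t + 1 - 2 * s) * X\<^sub>l ^ 4\<close>. As \<open>X\<^sub>l\<close> has variance \<open>\<parallel>K (e l)\<parallel>\<^sup>2\<close>, of the
  order \<open>l powr (- 2 * t)\<close> at most, the expectations of these terms are of the order
  \<open>l powr (1 - 2 * s - 2 * t)\<close> at most, and they are summable because \<open>s + t > 1\<close>.\<close>

lemma bregman_bound:
  assumes t: "t > 1/2" and s: "s \<ge> 1/2" and N: "white_noise M N"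
    and source: "\<forall>l\<ge>1. \<exists>w. Kadj w = e l" and u: "finite (supp u)"
  shows "\<exists>A Z. 0 \<le> A \<and> integrable M Z \<and>
    (AE \<omega> in M. \<forall>\<alpha> \<delta> U \<mu>. \<alpha> > 0 \<longrightarrow> \<delta> > 0 \<longrightarrow>
      regularized_solution \<psi> K (besov_penalty \<psi> s) (data (K u) (N \<omega>) \<delta>) \<alpha> U \<mu> \<longrightarrow>
      bregman \<mu> (sgn_subgradient s u) U u \<in> {0 .. A * \<alpha> + \<delta> ^ 4 / \<alpha> ^ 3 * Z \<omega>})"
proof -
  define a where "a l = real l powr (s - 1/2)" for l :: nat
  define b where "b l = real l powr t" for l :: nat
  define X where "X \<omega> l = pairing \<psi> (dist_of (K (e l))) (N \<omega>)" for \<omega> l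
  obtain w where w: "Kadj w = sgn_subgradient s u"
    using source_sum[OF source supp_ge_1,
        where c = "\<lambda>l. real l powr (s - 1/2) * sgn (inner u (e l))"]
    unfolding sgn_subgradient_def by blast
  have stable: "\<exists>W. Kadj W = (\<Sum>l\<in>B. c l *\<^sub>R e l) \<and> (norm W)\<^sup>2 \<le> C\<^sup>2 * (\<Sum>l\<in>B. (b l * c l)\<^sup>2)"
    if B: "finite B" "B \<subseteq> {1..}" for B c
    using source_sum[OF source B(2), of c] norm_source_le[OF B] unfolding b_def by blast
  have "summable (\<lambda>l. (b l / a l)\<^sup>2 * norm (K (e l)) ^ 4)"
  proof (rule summable_comparison_test)
    have "norm ((b l / a l)\<^sup>2 * norm (K (e l)) ^ 4) \<le> C ^ 4 * real l powr (1 - 2 * s - 2 * t)" for l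
    proof (cases "l = 0")
      case False
      have "b l / a l = real l powr (t - (s - 1/2))"
        by (simp only: a_def b_def powr_diff)
      then have ratio: "(b l / a l)\<^sup>2 = real l powr (2 * t + 1 - 2 * s)"
        using False by (simp add: powr_power algebra_simps)
      have "norm ((b l / a l)\<^sup>2 * norm (K (e l)) ^ 4) \<le> (b l / a l)\<^sup>2 * (C * real l powr (- t)) ^ 4"
        using norm_image_basis[of l] False by (auto intro!: mult_left_mono power_mono)
      also have "(C * real l powr (- t)) ^ 4 = C ^ 4 * real l powr (- 4 * t)"
        using False by (simp add: power_mult_distrib powr_power)
      also have "(b l / a l)\<^sup>2 * (C ^ 4 * real l powr (- 4 * t))
          = C ^ 4 * real l powr ((2 * t + 1 - 2 * s) + - 4 * t)"
        by (simp only: ratio powr_add mult.left_commute)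
      also have "(2 * t + 1 - 2 * s) + - 4 * t = 1 - 2 * s - 2 * t" by simp
      finally show ?thesis .
    qed (simp add: b_def)
    then show "\<exists>n0. \<forall>l\<ge>n0. norm ((b l / a l)\<^sup>2 * norm (K (e l)) ^ 4) \<le> C ^ 4 * real l powr (1 - 2 * s - 2 * t)"
      by blast
    show "summable (\<lambda>l. C ^ 4 * real l powr (1 - 2 * s - 2 * t))"
      using s t by (intro summable_mult) (simp add: summable_real_powr_iff)
  qed
  then have "\<exists>Z. integrable M Z \<and> (AE \<omega> in M. \<forall>n. (\<Sum>l=1..n. (b l / a l)\<^sup>2 * X \<omega> l ^ 4) \<le> Z \<omega>)"
    unfolding X_def by (intro white_noise_fourth_moment_series[OF N t range_smooth]) auto
  then obtain Z where Z: "integrable M Z" "AE \<omega> in M. \<forall>n. (\<Sum>l=1..n. (b l / a l)\<^sup>2 * X \<omega> l ^ 4) \<le> Z \<omega>"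
    by blast
  define A where "A = C\<^sup>2 / 4 * (\<Sum>l\<in>supp u. (a l * b l)\<^sup>2) + (norm w)\<^sup>2"
  have "AE \<omega> in M. \<forall>\<alpha> \<delta> U \<mu>. \<alpha> > 0 \<longrightarrow> \<delta> > 0 \<longrightarrow>
      regularized_solution \<psi> K (besov_penalty \<psi> s) (data (K u) (N \<omega>) \<delta>) \<alpha> U \<mu> \<longrightarrow>
      bregman \<mu> (sgn_subgradient s u) U u \<in> {0 .. A * \<alpha> + \<delta> ^ 4 / \<alpha> ^ 3 * (4 * C\<^sup>2 * Z \<omega>)}"
    using Z(2) white_noise_regularity[OF N t]
  proof (eventually_elim, intro allI impI)
    fix \<omega> \<alpha> \<delta> U \<mu>
    assume z: "\<forall>n. (\<Sum>l=1..n. (b l / a l)\<^sup>2 * X \<omega> l ^ 4) \<le> Z \<omega>"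
      and n: "(\<lambda>l. real l powr (- 2 * t) * (N \<omega> (\<psi> l))\<^sup>2) summable_on {1..}"
      and pos: "\<alpha> > 0" "\<delta> > 0"
      and sol: "regularized_solution \<psi> K (besov_penalty \<psi> s) (data (K u) (N \<omega>) \<delta>) \<alpha> U \<mu>"
    have dom: "(\<Sum>l\<in>{1..n} - supp u. a l * \<bar>inner (U - u) (e l)\<bar>) \<le> inner (\<mu> - sgn_subgradient s u) (U - u)" for n
      unfolding a_def using sol by (intro bregman_dominates u) (simp add: regularized_solution_def)
    have "inner (\<mu> - sgn_subgradient s u) (U - u)
        \<le> \<alpha> * (C\<^sup>2 / 4 * (\<Sum>l\<in>supp u. (a l * b l)\<^sup>2) + (norm w)\<^sup>2) + 4 * C\<^sup>2 * \<delta> ^ 4 / \<alpha> ^ 3 * Z \<omega>"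
    proof (rule bregman_estimate[OF pos _ adjoint stable w _ u supp_ge_1 dom])
      show "inner (K (e l)) (K (U - u)) - \<delta> * X \<omega> l + \<alpha> * inner \<mu> (e l) = 0" if "l \<ge> 1" for l
        unfolding X_def by (rule optimality_coefficient[OF sol that n])
    qed (use z in \<open>auto simp: a_def\<close>)
    then show "bregman \<mu> (sgn_subgradient s u) U u \<in> {0 .. A * \<alpha> + \<delta> ^ 4 / \<alpha> ^ 3 * (4 * C\<^sup>2 * Z \<omega>)}"
      using dom[of 0] by (simp add: bregman_def A_def mult_ac)
  qed
  moreover have "0 \<le> A" by (simp add: A_def sum_nonneg)
  moreover have "integrable M (\<lambda>\<omega>. 4 * C\<^sup>2 * Z \<omega>)" using Z(1) by simp
  ultimately show ?thesis by blast
qed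

end

text \<open>For \<open>\<alpha>\<close> of the order \<open>\<delta> powr \<kappa>\<close> the second term of the bound has order \<open>4 - 3 * \<kappa>\<close>, which is
  at least \<open>\<kappa>\<close> as soon as \<open>\<kappa> \<le> 1\<close>.\<close>

lemma rate_of_bound:
  fixes \<alpha> d :: "real \<Rightarrow> real" and \<kappa> A B :: real
  assumes \<kappa>: "\<kappa> \<le> 1" and \<alpha>: "\<And>\<delta>. \<delta> > 0 \<Longrightarrow> \<alpha> \<delta> > 0" "\<alpha> \<in> \<Theta>[at_right 0](\<lambda>\<delta>. \<delta> powr \<kappa>)"
    and "A \<ge> 0" and d: "\<And>\<delta>. \<delta> > 0 \<Longrightarrow> d \<delta> \<le> A * \<alpha> \<delta> + \<delta> ^ 4 / \<alpha> \<delta> ^ 3 * B"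
  shows "\<exists>C>0. \<forall>\<^sub>F \<delta> in at_right 0. d \<delta> \<le> C * \<delta> powr \<kappa>"
proof -
  obtain c2 where c2: "c2 > 0" "\<forall>\<^sub>F \<delta> in at_right 0. norm (\<alpha> \<delta>) \<le> c2 * norm (\<delta> powr \<kappa>)"
    using bigthetaD1[OF \<alpha>(2)] by (elim landau_o.bigE)
  obtain c1 where c1: "c1 > 0" "\<forall>\<^sub>F \<delta> in at_right 0. norm (\<alpha> \<delta>) \<ge> c1 * norm (\<delta> powr \<kappa>)"
    using bigthetaD2[OF \<alpha>(2)] by (elim landau_omega.bigE)
  have "\<forall>\<^sub>F \<delta> in at_right (0::real). \<delta> \<in> {0<..<1}"
    by (rule eventually_at_right_real) simp
  with c1(2) c2(2) have "\<forall>\<^sub>F \<delta> in at_right 0. d \<delta> \<le> (A * c2 + \<bar>B\<bar> / c1 ^ 3 + 1) * \<delta> powr \<kappa>"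
  proof eventually_elim
    case (elim \<delta>)
    then have \<delta>: "0 < \<delta>" "\<delta> < 1" by auto
    have up: "\<alpha> \<delta> \<le> c2 * \<delta> powr \<kappa>" and low: "c1 * \<delta> powr \<kappa> \<le> \<alpha> \<delta>"
      using elim \<alpha>(1)[OF \<delta>(1)] by auto
    have "\<delta> ^ 4 / \<alpha> \<delta> ^ 3 \<le> \<delta> ^ 4 / (c1 * \<delta> powr \<kappa>) ^ 3"
      using low c1(1) \<delta> by (intro divide_left_mono power_mono mult_pos_pos zero_less_power \<alpha>) auto
    also have "\<dots> = \<delta> powr (4 - 3 * \<kappa>) / c1 ^ 3"
    proof -
      have "\<delta> ^ 4 = \<delta> powr 4" using \<delta> by simp
      moreover have "(\<delta> powr \<kappa>) ^ 3 = \<delta> powr (3 * \<kappa>)"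
        using \<delta> by (simp add: powr_power mult.commute)
      ultimately show ?thesis
        by (simp only: power_mult_distrib powr_diff divide_divide_eq_left mult.commute)
    qed
    also have "\<dots> \<le> \<delta> powr \<kappa> / c1 ^ 3"
      using \<delta> \<kappa> c1(1) by (intro divide_right_mono powr_mono') auto
    finally have "\<delta> ^ 4 / \<alpha> \<delta> ^ 3 * B \<le> \<delta> powr \<kappa> / c1 ^ 3 * \<bar>B\<bar>"
      using \<delta> \<alpha>(1)[OF \<delta>(1)]
      by (intro order_trans[OF mult_left_mono[OF abs_ge_self] mult_right_mono]) auto
    moreover have "A * \<alpha> \<delta> \<le> A * (c2 * \<delta> powr \<kappa>)"
      using up \<open>A \<ge> 0\<close> by (rule mult_left_mono)
    ultimately have "d \<delta> \<le> A * (c2 * \<delta> powr \<kappa>) + \<delta> powr \<kappa> / c1 ^ 3 * \<bar>B\<bar>"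
      using d[OF \<delta>(1)] by linarith
    also have "\<dots> \<le> (A * c2 + \<bar>B\<bar> / c1 ^ 3 + 1) * \<delta> powr \<kappa>"
      by (simp add: algebra_simps)
    finally show ?case .
  qed
  moreover have "A * c2 + \<bar>B\<bar> / c1 ^ 3 + 1 > 0"
    using \<open>A \<ge> 0\<close> c1 c2 by (intro add_nonneg_pos) auto
  ultimately show ?thesis by blast
qed

theorem theorem4p7:
  fixes t s \<kappa> :: real
    and \<psi> :: "nat \<Rightarrow> real \<Rightarrow> real"
    and K Kadj :: "L2_torus \<Rightarrow> L2_torus"
    and u_true :: L2_torus
    and M :: "'w measure"
    and N :: "'w \<Rightarrow> (real \<Rightarrow> real) \<Rightarrow> real"
  defines "R \<equiv> besov_penalty \<psi> s"
    and "S \<equiv> (\<lambda>q. besov_infty_norm \<psi> (- s) (dist_of q))"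
  assumes t: "t > 1/2" and s: "s \<ge> 1/2"
    and \<kappa>: "\<kappa> = (2 * s + 2 * t) / (2 * s + 2 * t + 1)"
    and wavelets: "wavelet_basis \<psi>"
    and K: "bounded_linear K"
    and adjoint: "\<And>f g. inner (K f) g = inner f (Kadj g)"
    and source: "\<forall>l\<ge>1. \<exists>w. Kadj w = L2_class (\<psi> l)"
    and smoothing: "\<exists>C>0. smoothing_with \<psi> t C (transposed \<psi> Kadj) \<and>
                           smoothing_with \<psi> t C (transposed \<psi> K)"
    and finite_support: "finite {l. l \<ge> 1 \<and> inner u_true (L2_class (\<psi> l)) \<noteq> 0}"
    and noise: "white_noise M N"
  shows "\<exists>\<mu>_true \<in> subdifferential R u_true.
      (\<forall>r1\<ge>0. \<exists>C1>0. \<forall>\<^sub>F \<beta> in at_right 0.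
         (INF w\<in>{w. S (\<mu>_true - Kadj w) \<le> ereal \<beta>}. ereal ((norm w)\<^sup>2))
           \<le> ereal (C1 * \<beta> powr (- r1))) \<and>
      (\<forall>\<alpha> U \<mu>.
         (\<forall>\<delta>>0. \<alpha> \<delta> > 0) \<and> \<alpha> \<in> \<Theta>[at_right 0](\<lambda>\<delta>. \<delta> powr \<kappa>) \<and>
         (\<forall>\<delta>>0. U \<delta> \<in> borel_measurable M \<and> \<mu> \<delta> \<in> borel_measurable M \<and>
            (AE \<omega> in M. regularized_solution \<psi> K R (data (K u_true) (N \<omega>) \<delta>) (\<alpha> \<delta>)
                          (U \<delta> \<omega>) (\<mu> \<delta> \<omega>)))
         \<longrightarrow> (\<exists>C>0. \<forall>\<^sub>F \<delta> in at_right 0.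
               integrable M (\<lambda>\<omega>. bregman (\<mu> \<delta> \<omega>) \<mu>_true (U \<delta> \<omega>) u_true) \<and>
               (\<integral>\<omega>. bregman (\<mu> \<delta> \<omega>) \<mu>_true (U \<delta> \<omega>) u_true \<partial>M) \<le> C * \<delta> powr \<kappa>))"
proof -
  interpret wavelets \<psi> by unfold_locales (rule wavelets)
  obtain C where C: "C > 0" "smoothing_with \<psi> t C (transposed \<psi> Kadj)" "smoothing_with \<psi> t C (transposed \<psi> K)"
    using smoothing by blast
  interpret smoothing_operator \<psi> K Kadj t C
    by unfold_locales (use adjoint C in auto)
  have u: "finite (supp u_true)"
    using finite_support by (simp add: supp_def)
  define \<nu> where "\<nu> = sgn_subgradient s u_true"
  obtain w where w: "Kadj w = \<nu>"
    using source_sum[OF source supp_ge_1,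
        where c = "\<lambda>l. real l powr (s - 1/2) * sgn (inner u_true (e l))"]
    unfolding \<nu>_def sgn_subgradient_def by blast
  \<comment> \<open>Since \<open>w\<close> is an exact source element, the infimum is bounded independently of \<open>\<beta>\<close>.\<close>
  have approx: "\<exists>C1>0. \<forall>\<^sub>F \<beta> in at_right 0.
      (INF w\<in>{w. S (\<nu> - Kadj w) \<le> ereal \<beta>}. ereal ((norm w)\<^sup>2)) \<le> ereal (C1 * \<beta> powr (- r1))"
    if "r1 \<ge> 0" for r1
  proof (intro exI[of _ "(norm w)\<^sup>2 + 1"] conjI)
    have "\<forall>\<^sub>F \<beta> in at_right (0::real). \<beta> \<in> {0<..<1}"
      by (rule eventually_at_right_real) simp
    then show "\<forall>\<^sub>F \<beta> in at_right 0.
        (INF w\<in>{w. S (\<nu> - Kadj w) \<le> ereal \<beta>}. ereal ((norm w)\<^sup>2)) \<le> ereal (((norm w)\<^sup>2 + 1) * \<beta> powr (- r1))"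
    proof eventually_elim
      case (elim \<beta>)
      have "S (\<nu> - Kadj w) \<le> ereal \<beta>"
        using elim by (simp add: S_def w besov_infty_norm_def dist_of_def SUP_le_iff)
      then have "(INF w\<in>{w. S (\<nu> - Kadj w) \<le> ereal \<beta>}. ereal ((norm w)\<^sup>2)) \<le> ereal ((norm w)\<^sup>2)"
        by (intro INF_lower) simp
      also have "1 \<le> \<beta> powr (- r1)"
        using elim that powr_mono'[of "- r1" 0 \<beta>] by simp
      then have "((norm w)\<^sup>2 + 1) * 1 \<le> ((norm w)\<^sup>2 + 1) * \<beta> powr (- r1)"
        by (intro mult_left_mono) auto
      then have "ereal ((norm w)\<^sup>2) \<le> ereal (((norm w)\<^sup>2 + 1) * \<beta> powr (- r1))"
        by simp
      finally show ?case .
    qed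
  qed (simp add: add_nonneg_pos)
  have rate: "\<exists>C>0. \<forall>\<^sub>F \<delta> in at_right 0.
      integrable M (\<lambda>\<omega>. bregman (\<mu> \<delta> \<omega>) \<nu> (U \<delta> \<omega>) u_true) \<and>
      (\<integral>\<omega>. bregman (\<mu> \<delta> \<omega>) \<nu> (U \<delta> \<omega>) u_true \<partial>M) \<le> C * \<delta> powr \<kappa>"
    if \<alpha>: "\<And>\<delta>. \<delta> > 0 \<Longrightarrow> \<alpha> \<delta> > 0" "\<alpha> \<in> \<Theta>[at_right 0](\<lambda>\<delta>. \<delta> powr \<kappa>)"
      and meas: "\<And>\<delta>. \<delta> > 0 \<Longrightarrow> U \<delta> \<in> borel_measurable M" "\<And>\<delta>. \<delta> > 0 \<Longrightarrow> \<mu> \<delta> \<in> borel_measurable M"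
      and sol: "\<And>\<delta>. \<delta> > 0 \<Longrightarrow> AE \<omega> in M.
        regularized_solution \<psi> K R (data (K u_true) (N \<omega>) \<delta>) (\<alpha> \<delta>) (U \<delta> \<omega>) (\<mu> \<delta> \<omega>)"
    for \<alpha> U \<mu>
  proof -
    interpret prob_space M using noise by (simp add: white_noise_def)
    obtain A Z where A: "A \<ge> 0" and Z: "integrable M Z"
      and bound: "AE \<omega> in M. \<forall>\<alpha> \<delta> U \<mu>. \<alpha> > 0 \<longrightarrow> \<delta> > 0 \<longrightarrow>
        regularized_solution \<psi> K R (data (K u_true) (N \<omega>) \<delta>) \<alpha> U \<mu> \<longrightarrow>
        bregman \<mu> \<nu> U u_true \<in> {0 .. A * \<alpha> + \<delta> ^ 4 / \<alpha> ^ 3 * Z \<omega>}"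
      using bregman_bound[OF t s noise source u] unfolding R_def \<nu>_def by blast
    define d where "d \<delta> \<omega> = bregman (\<mu> \<delta> \<omega>) \<nu> (U \<delta> \<omega>) u_true" for \<delta> \<omega>
    have d: "integrable M (d \<delta>)" "(\<integral>\<omega>. d \<delta> \<omega> \<partial>M) \<le> A * \<alpha> \<delta> + \<delta> ^ 4 / \<alpha> \<delta> ^ 3 * (\<integral>\<omega>. Z \<omega> \<partial>M)"
      if \<delta>: "\<delta> > 0" for \<delta>
    proof -
      have ae: "AE \<omega> in M. d \<delta> \<omega> \<in> {0 .. A * \<alpha> \<delta> + \<delta> ^ 4 / \<alpha> \<delta> ^ 3 * Z \<omega>}"
        using bound sol[OF \<delta>] by eventually_elim (use \<delta> \<alpha>(1) in \<open>auto simp: d_def\<close>)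
      have int: "integrable M (\<lambda>\<omega>. A * \<alpha> \<delta> + \<delta> ^ 4 / \<alpha> \<delta> ^ 3 * Z \<omega>)"
        using Z by (intro Bochner_Integration.integrable_add integrable_mult_right) auto
      have "d \<delta> \<in> borel_measurable M"
        unfolding d_def[abs_def] bregman_def using meas \<delta> by (intro measurable_inner) auto
      with int show di: "integrable M (d \<delta>)"
        by (rule Bochner_Integration.integrable_bound) (use ae in \<open>eventually_elim, auto\<close>)
      have "(\<integral>\<omega>. d \<delta> \<omega> \<partial>M) \<le> (\<integral>\<omega>. A * \<alpha> \<delta> + \<delta> ^ 4 / \<alpha> \<delta> ^ 3 * Z \<omega> \<partial>M)"
        by (rule integral_mono_AE[OF di int]) (use ae in \<open>eventually_elim, auto\<close>)
      also have "\<dots> = A * \<alpha> \<delta> + \<delta> ^ 4 / \<alpha> \<delta> ^ 3 * (\<integral>\<omega>. Z \<omega> \<partial>M)"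
        using Z by (simp add: prob_space)
      finally show "(\<integral>\<omega>. d \<delta> \<omega> \<partial>M) \<le> A * \<alpha> \<delta> + \<delta> ^ 4 / \<alpha> \<delta> ^ 3 * (\<integral>\<omega>. Z \<omega> \<partial>M)" .
    qed
    have "\<kappa> \<le> 1" unfolding \<kappa> using s t by simp
    from rate_of_bound[OF this \<alpha> A d(2)] obtain C
      where C: "C > 0" "\<forall>\<^sub>F \<delta> in at_right 0. (\<integral>\<omega>. d \<delta> \<omega> \<partial>M) \<le> C * \<delta> powr \<kappa>"
      by blast
    have "\<forall>\<^sub>F \<delta> in at_right 0. integrable M (d \<delta>) \<and> (\<integral>\<omega>. d \<delta> \<omega> \<partial>M) \<le> C * \<delta> powr \<kappa>"
      using C(2) eventually_at_right_less[of "0::real"] by eventually_elim (use d(1) in simp)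
    with C(1) show ?thesis unfolding d_def[abs_def] by blast
  qed
  have mem: "\<nu> \<in> subdifferential R u_true"
    unfolding R_def \<nu>_def by (rule sgn_subgradient_mem[OF u])
  show ?thesis
  proof (rule bexI[OF _ mem], intro conjI allI impI)
    fix \<alpha> U \<mu>
    assume "(\<forall>\<delta>>0. \<alpha> \<delta> > 0) \<and> \<alpha> \<in> \<Theta>[at_right 0](\<lambda>\<delta>. \<delta> powr \<kappa>) \<and>
      (\<forall>\<delta>>0. U \<delta> \<in> borel_measurable M \<and> \<mu> \<delta> \<in> borel_measurable M \<and>
        (AE \<omega> in M. regularized_solution \<psi> K R (data (K u_true) (N \<omega>) \<delta>) (\<alpha> \<delta>) (U \<delta> \<omega>) (\<mu> \<delta> \<omega>)))"
    then show "\<exists>C>0. \<forall>\<^sub>F \<delta> in at_right 0.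
        integrable M (\<lambda>\<omega>. bregman (\<mu> \<delta> \<omega>) \<nu> (U \<delta> \<omega>) u_true) \<and>
        (\<integral>\<omega>. bregman (\<mu> \<delta> \<omega>) \<nu> (U \<delta> \<omega>) u_true \<partial>M) \<le> C * \<delta> powr \<kappa>"
      by (intro rate[where \<alpha> = \<alpha> and U = U and \<mu> = \<mu>]) auto
  qed (rule approx)
qed

end
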